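(* Let $-1\le q<0$ and $s\ge 1/(2+q)$. Then for every $n$, the map $(A,B)\mapsto\Phi_{2,q,s}(A,B)=\mathrm{Tr}[(A^{q/2}B^2A^{q/2})^s]$ is jointly convex on $\mathcal{P}_n\times\mathcal{P}_n$.
   Context: $\mathcal{P}_n$ denotes the set of $n\times n$ positive definite complex matrices; $\Phi_{p,q,s}(A,B)=\mathrm{Tr}[(A^{q/2}B^pA^{q/2})^s]$. *)

theory Defs
  imports "Jordan_Normal_Form.Matrix" Complex_Main
begin

definition cadj :: "complex mat \<Rightarrow> complex mat" where
  "cadj A = mat (dim_col A) (dim_row A) (\<lambda>(i,j). cnj (A $$ (j,i)))"

definition ctrace :: "complex mat \<Rightarrow> complex" where
  "ctrace A = (\<Sum>i<dim_row A. A $$ (i,i))"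

definition pos_def_mats :: "nat \<Rightarrow> complex mat set" where
  "pos_def_mats n = {A. A \<in> carrier_mat n n \<and> cadj A = A \<and>
     (\<forall>v \<in> carrier_vec n. v \<noteq> 0\<^sub>v n \<longrightarrow> 0 < Re (conjugate v \<bullet> (A *\<^sub>v v)))}"

definition real_diag_mat :: "nat \<Rightarrow> (nat \<Rightarrow> real) \<Rightarrow> complex mat" where
  "real_diag_mat n d = mat n n (\<lambda>(i,j). if i = j then complex_of_real (d i) else 0)"

definition mat_powr :: "complex mat \<Rightarrow> real \<Rightarrow> complex mat" where
  "mat_powr A r = (SOME M. \<exists>U d. U \<in> carrier_mat (dim_row A) (dim_row A) \<and>
      cadj U * U = 1\<^sub>m (dim_row A) \<and> (\<forall>i < dim_row A. 0 < d i) \<and>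
      A = U * real_diag_mat (dim_row A) d * cadj U \<and>
      M = U * real_diag_mat (dim_row A) (\<lambda>i. d i powr r) * cadj U)"

(* Phi_{p,q,s}(A,B) = Tr[(A^{q/2} B^p A^{q/2})^s]  (a real number for A, B positive definite) *)
definition Phi :: "real \<Rightarrow> real \<Rightarrow> real \<Rightarrow> complex mat \<Rightarrow> complex mat \<Rightarrow> real" where
  "Phi p q s A B = Re (ctrace (mat_powr
      (mat_powr A (q/2) * mat_powr B p * mat_powr A (q/2)) s))"

end

theory Submission
  imports "HOL-Analysis.Equivalence_Lebesgue_Henstock_Integration"
    "Jordan_Normal_Form.Spectral_Radius" Defs
begin

unbundle no inner_syntax
unbundle no vec_syntax

text \<open>Put \<open>a = -q\<close>. By polar decomposition \<open>\<Phi>(A, B) = Tr X\<^sup>s\<close> with \<open>X = B A\<^sup>-\<^sup>a B\<close>. The scalar function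
  \<open>x\<^sup>-\<^sup>a y\<^sup>a\<^sup>-\<^sup>1\<close> is a mixture of resolvents \<open>1 / (\<tau> x + y)\<close>, and each resolvent gives the jointly convex
  function \<open>(A, K, C) \<mapsto> sup\<^sub>Z 2 Re Tr Z\<^sup>* K - \<tau> Tr Z\<^sup>* A Z - Tr Z C Z\<^sup>*\<close>; hence
  \<open>Tr (K\<^sup>* A\<^sup>-\<^sup>a K C\<^sup>a\<^sup>-\<^sup>1)\<close> is jointly convex (Lieb). A variational formula for \<open>Tr X\<^sup>s\<close>, which is
  Young's inequality summed against a doubly stochastic matrix, writes \<open>\<Phi>\<close> as an infimum (\<open>s < 1\<close>) of
  functions jointly convex together with the extra variable, or as a supremum (\<open>s \<ge> 1\<close>) of jointly
  convex functions.\<close>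

section \<open>Adjoints and unitary matrices\<close>

text \<open>The powers in \<open>Phi\<close> are picked by a choice operator. Every inequality is
  therefore proved for arbitrary spectral decompositions, so whichever one is picked fits. Matrices
  enter the estimates only through squared moduli of entries of \<open>cadj U * K * W\<close>, which
  reduces each trace inequality to a scalar one. The exponents -a and a - 1 add up to -1; with the
  quadratic dependence on K the form has degree one, like a resolvent form. The power p = 2 is what
  lets B itself play the role of K. An infimum of convex functions need not be convex. For s < 1 the
  extra variable must move along with (A, B): minimisers D1, D2 at the end points yield the
  competitor t D1 + (1 - t) D2 in between, at the price of needing Tr D^k convex. For s >= 1 the
  maximiser found in between is frozen and tested at both end points.\<close>

lemma index_mult_mat_sum:
  assumes "A \<in> carrier_mat n m" "B \<in> carrier_mat m k" "i < n" "j < k"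
  shows "(A * B) $$ (i,j) = (\<Sum>l<m. A $$ (i,l) * B $$ (l,j))"
  using assms by (simp add: scalar_prod_def lessThan_atLeast0)

lemma mult_square_carrier [simp]:
  "A \<in> carrier_mat n n \<Longrightarrow> B \<in> carrier_mat n n \<Longrightarrow> A * B \<in> carrier_mat n n"
  by (rule mult_carrier_mat)

lemma cadj_carrier [simp]: "A \<in> carrier_mat n m \<Longrightarrow> cadj A \<in> carrier_mat m n"
  by (simp add: cadj_def)

lemma cadj_index [simp]: "i < dim_col A \<Longrightarrow> j < dim_row A \<Longrightarrow> cadj A $$ (i,j) = cnj (A $$ (j,i))"
  by (simp add: cadj_def)

lemma cadj_cadj [simp]: "cadj (cadj A) = A"
  by (rule eq_matI) (auto simp: cadj_def)

lemma cadj_one [simp]: "cadj (1\<^sub>m n) = 1\<^sub>m n"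
  by (rule eq_matI) (auto simp: cadj_def)

lemma cadj_mult:
  assumes "A \<in> carrier_mat n m" "B \<in> carrier_mat m k"
  shows "cadj (A * B) = cadj B * cadj A"
proof (rule eq_matI)
  fix i j assume "i < dim_row (cadj B * cadj A)" "j < dim_col (cadj B * cadj A)"
  then have ij: "i < k" "j < n" using assms by (auto simp: cadj_def)
  have "cadj (A * B) $$ (i,j) = cnj ((A * B) $$ (j,i))" using assms ij by (intro cadj_index) auto
  also have "\<dots> = (\<Sum>l<m. cnj (A $$ (j,l)) * cnj (B $$ (l,i)))"
    by (subst index_mult_mat_sum[OF assms ij(2) ij(1)]) simp
  also have "\<dots> = (\<Sum>l<m. cadj B $$ (i,l) * cadj A $$ (l,j))"
    using assms ij by (intro sum.cong) (auto simp: mult.commute)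
  also have "\<dots> = (cadj B * cadj A) $$ (i,j)"
    using assms ij by (subst index_mult_mat_sum[of _ k m _ n]) auto
  finally show "cadj (A * B) $$ (i,j) = (cadj B * cadj A) $$ (i,j)" .
qed (use assms in \<open>auto simp: cadj_def\<close>)

lemma cadj_add:
  assumes "A \<in> carrier_mat n m" "B \<in> carrier_mat n m"
  shows "cadj (A + B) = cadj A + cadj B"
  by (rule eq_matI) (use assms in \<open>auto simp: cadj_def\<close>)

lemma cadj_smult_real:
  "cadj (complex_of_real t \<cdot>\<^sub>m A) = complex_of_real t \<cdot>\<^sub>m cadj A"
  by (rule eq_matI) (auto simp: cadj_def)

lemma real_diag_carrier [simp]: "real_diag_mat n d \<in> carrier_mat n n"
  by (simp add: real_diag_mat_def)

lemma real_diag_dim [simp]: "dim_row (real_diag_mat n d) = n" "dim_col (real_diag_mat n d) = n"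
  by (simp_all add: real_diag_mat_def)

lemma real_diag_index [simp]:
  "i < n \<Longrightarrow> j < n \<Longrightarrow> real_diag_mat n d $$ (i,j) = (if i = j then complex_of_real (d i) else 0)"
  by (simp add: real_diag_mat_def)

lemma cadj_real_diag [simp]: "cadj (real_diag_mat n d) = real_diag_mat n d"
  by (rule eq_matI) (auto simp: cadj_def real_diag_mat_def)

lemma real_diag_mult_index:
  assumes "Y \<in> carrier_mat n m" "i < n" "j < m"
  shows "(real_diag_mat n d * Y) $$ (i,j) = d i * Y $$ (i,j)"
proof -
  have "(real_diag_mat n d * Y) $$ (i,j) = (\<Sum>l<n. if l = i then d i * Y $$ (l,j) else 0)"
    using assms by (subst index_mult_mat_sum[of _ n n _ m]) (simp_all cong: if_cong add: if_distrib[of "\<lambda>x. x * _"] eq_commute)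
  then show ?thesis using assms by simp
qed

lemma mult_real_diag_index:
  assumes "Y \<in> carrier_mat m n" "i < m" "j < n"
  shows "(Y * real_diag_mat n d) $$ (i,j) = d j * Y $$ (i,j)"
proof -
  have "(Y * real_diag_mat n d) $$ (i,j) = (\<Sum>l<n. if l = j then d j * Y $$ (i,l) else 0)"
    using assms by (subst index_mult_mat_sum[of _ m n _ n]) (simp_all cong: if_cong add: if_distrib[of "\<lambda>x. _ * x"] mult.commute)
  then show ?thesis using assms by simp
qed

lemma real_diag_mult: "real_diag_mat n d * real_diag_mat n e = real_diag_mat n (\<lambda>i. d i * e i)"
  by (rule eq_matI) (auto simp: real_diag_mult_index[of _ n n] simp del: index_mult_mat(1))

lemma real_diag_one: "(\<And>i. i < n \<Longrightarrow> d i = 1) \<Longrightarrow> real_diag_mat n d = 1\<^sub>m n"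
  by (rule eq_matI) auto

lemma real_diag_cong: "(\<And>i. i < n \<Longrightarrow> d i = e i) \<Longrightarrow> real_diag_mat n d = real_diag_mat n e"
  by (rule eq_matI) auto

definition unitary_mat :: "nat \<Rightarrow> complex mat \<Rightarrow> bool" where
  "unitary_mat n U \<longleftrightarrow> U \<in> carrier_mat n n \<and> cadj U * U = 1\<^sub>m n \<and> U * cadj U = 1\<^sub>m n"

lemma unitary_matD:
  assumes "unitary_mat n U"
  shows "U \<in> carrier_mat n n" "cadj U * U = 1\<^sub>m n" "U * cadj U = 1\<^sub>m n"
  using assms by (auto simp: unitary_mat_def)

lemma unitary_matI:
  assumes "U \<in> carrier_mat n n" "cadj U * U = 1\<^sub>m n"
  shows "unitary_mat n U"
  using assms mat_mult_left_right_inverse[of "cadj U" n U] by (auto simp: unitary_mat_def)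

lemma unitary_one: "unitary_mat n (1\<^sub>m n)"
  by (rule unitary_matI) auto

lemma unitary_cadj: "unitary_mat n U \<Longrightarrow> unitary_mat n (cadj U)"
  by (auto simp: unitary_mat_def)

text \<open>Associativity holds only under carrier conditions, so products are normalised to the
  right and an inverse pair is then cancelled at the head.\<close>

lemma cancel_mult_mat:
  fixes P Q R :: "'a :: semiring_1 mat"
  assumes "P * Q = 1\<^sub>m n" "P \<in> carrier_mat n n" "Q \<in> carrier_mat n n" "R \<in> carrier_mat n m"
  shows "P * (Q * R) = R"
  using assms by (simp add: left_mult_one_mat[of R n m] flip: assoc_mult_mat[of P n n Q n R m])

lemma unitary_mult:
  assumes "unitary_mat n U" "unitary_mat n V"
  shows "unitary_mat n (U * V)"
proof (rule unitary_matI)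
  note [simp] = unitary_matD[OF assms(1)] unitary_matD[OF assms(2)]
  show "U * V \<in> carrier_mat n n" by auto
  have "cadj (U * V) * (U * V) = cadj V * (cadj U * (U * V))"
    by (simp add: cadj_mult[of U n n V n] assoc_mult_mat[of _ n n _ n _ n])
  also have "cadj U * (U * V) = V" by (rule cancel_mult_mat[of _ _ n _ n]) auto
  finally show "cadj (U * V) * (U * V) = 1\<^sub>m n" by simp
qed

text \<open>The bridge from matrices to scalars: for unitary Y the right-hand side is an average of
  the numbers \<open>d i\<close>.\<close>

lemma quadratic_form_diag:
  assumes "Y \<in> carrier_mat n m" "j < m"
  shows "(cadj Y * real_diag_mat n d * Y) $$ (j,j) = complex_of_real (\<Sum>i<n. d i * (cmod (Y $$ (i,j)))\<^sup>2)"
proof -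
  have "(cadj Y * real_diag_mat n d * Y) $$ (j,j)
      = (\<Sum>l<n. (cadj Y * real_diag_mat n d) $$ (j,l) * Y $$ (l,j))"
    using assms by (intro index_mult_mat_sum[of _ m n _ m] mult_carrier_mat[of _ m n]) auto
  also have "\<dots> = (\<Sum>l<n. d l * (cnj (Y $$ (l,j)) * Y $$ (l,j)))"
    using assms by (intro sum.cong) (auto simp: mult_real_diag_index[of _ m n] mult.assoc)
  also have "\<dots> = complex_of_real (\<Sum>i<n. d i * (cmod (Y $$ (i,j)))\<^sup>2)"
    by (simp add: complex_norm_square mult.commute[of "cnj _"] del: of_real_power)
  finally show ?thesis .
qed

text \<open>The quadratic form of the identity on a column. With the row sums below, the squared
  moduli of a unitary matrix are doubly stochastic.\<close>

lemma unitary_col_sum: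
  assumes "unitary_mat n U" "j < n"
  shows "(\<Sum>i<n. (cmod (U $$ (i,j)))\<^sup>2) = 1"
proof -
  note [simp] = unitary_matD[OF assms(1)]
  have "complex_of_real (\<Sum>i<n. 1 * (cmod (U $$ (i,j)))\<^sup>2) = (cadj U * real_diag_mat n (\<lambda>_. 1) * U) $$ (j,j)"
    using assms by (subst quadratic_form_diag[of _ n n]) auto
  also have "real_diag_mat n (\<lambda>_. 1) = 1\<^sub>m n" by (rule real_diag_one) simp
  also have "cadj U * 1\<^sub>m n * U = 1\<^sub>m n" by (simp add: right_mult_one_mat[of _ n n])
  finally show ?thesis using assms by (simp flip: of_real_power of_real_sum)
qed

lemma unitary_row_sum:
  assumes "unitary_mat n U" "i < n"
  shows "(\<Sum>j<n. (cmod (U $$ (i,j)))\<^sup>2) = 1"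
  using unitary_col_sum[OF unitary_cadj[OF assms(1)] assms(2)] unitary_matD(1)[OF assms(1)] assms(2)
  by simp

section \<open>Cyclicity and unitary invariance of the trace\<close>

lemma ctrace_comm:
  assumes "A \<in> carrier_mat n m" "B \<in> carrier_mat m n"
  shows "ctrace (A * B) = ctrace (B * A)"
proof -
  have "ctrace (A * B) = (\<Sum>i<n. \<Sum>l<m. A $$ (i,l) * B $$ (l,i))"
    using assms by (auto simp: ctrace_def index_mult_mat_sum[OF assms] simp del: index_mult_mat(1))
  also have "\<dots> = (\<Sum>l<m. \<Sum>i<n. B $$ (l,i) * A $$ (i,l))"
    by (subst sum.swap) (simp add: mult.commute)
  also have "\<dots> = ctrace (B * A)"
    using assms by (auto simp: ctrace_def index_mult_mat_sum[OF assms(2,1)] simp del: index_mult_mat(1))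
  finally show ?thesis .
qed

lemma ctrace_add:
  "A \<in> carrier_mat n n \<Longrightarrow> B \<in> carrier_mat n n \<Longrightarrow> ctrace (A + B) = ctrace A + ctrace B"
  by (auto simp: ctrace_def sum.distrib)

lemma ctrace_smult: "A \<in> carrier_mat n n \<Longrightarrow> ctrace (c \<cdot>\<^sub>m A) = c * ctrace A"
  by (auto simp: ctrace_def sum_distrib_left)

lemma ctrace_cong_unitary:
  assumes "unitary_mat n U" "A \<in> carrier_mat n n"
  shows "ctrace (U * A * cadj U) = ctrace A"
proof -
  note [simp] = unitary_matD[OF assms(1)] assms(2)
  have "ctrace (U * A * cadj U) = ctrace (cadj U * (U * A))"
    by (rule ctrace_comm[of _ n n]) auto
  then show ?thesis by (subst (asm) cancel_mult_mat[of _ _ n _ n]) auto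
qed

lemma ctrace_real_diag: "ctrace (real_diag_mat n d) = complex_of_real (\<Sum>i<n. d i)"
  by (simp add: ctrace_def real_diag_mat_def)

section \<open>The spectral theorem for positive definite matrices\<close>

text \<open>Neither U nor the order of the eigenvalues is determined by A; later results are stated
  for every admissible choice.\<close>

definition spectral :: "nat \<Rightarrow> complex mat \<Rightarrow> complex mat \<Rightarrow> (nat \<Rightarrow> real) \<Rightarrow> bool" where
  "spectral n A U d \<longleftrightarrow> unitary_mat n U \<and> (\<forall>i<n. 0 < d i) \<and> A = U * real_diag_mat n d * cadj U"

lemma spectralD:
  assumes "spectral n A U d"
  shows "unitary_mat n U" "\<And>i. i < n \<Longrightarrow> 0 < d i" "A = U * real_diag_mat n d * cadj U"
    "A \<in> carrier_mat n n" "U \<in> carrier_mat n n"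
  using assms unitary_matD[of n U] by (auto simp: spectral_def)

lemma unitary_first_column:
  fixes v :: "complex vec"
  assumes v: "v \<in> carrier_vec n" and v0: "v \<noteq> 0\<^sub>v n"
  shows "\<exists>W c. unitary_mat n W \<and> c \<noteq> 0 \<and> col W 0 = c \<cdot>\<^sub>v v"
proof -
  interpret cof_vec_space n "TYPE(complex)" .
  have n: "n \<noteq> 0" using v v0 by (auto intro: ccontr)
  define b where "b = basis_completion v"
  define ws where "ws = gram_schmidt n b"
  from basis_completion[OF v v0, folded b_def]
  have dist_b: "distinct b" and indep: "\<not> lin_dep (set b)" and b: "set b \<subseteq> carrier_vec n"
    and hdb: "hd b = v" and len_b: "length b = n" by auto
  from hdb len_b n obtain vs where bv: "b = v # vs" by (cases b, auto)
  from gram_schmidt_result[OF b dist_b indep refl, folded ws_def]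
  have ws: "set ws \<subseteq> carrier_vec n" "corthogonal ws" "length ws = n" by (auto simp: len_b)
  from gram_schmidt_hd[OF v, of vs, folded bv] have hdws: "hd ws = v" unfolding ws_def .
  have wsc: "ws ! j \<in> carrier_vec n" if "j < n" for j using ws that by auto
  have orth: "(\<Sum>i<n. cnj (ws ! k $ i) * ws ! j $ i) = 0 \<longleftrightarrow> j \<noteq> k" if "j < n" "k < n" for j k
    using corthogonalD[OF ws(2), of j k] that ws(3) wsc[OF that(1)] wsc[OF that(2)]
    by (simp add: scalar_prod_def lessThan_atLeast0 mult.commute)
  define N where "N j = (\<Sum>i<n. (cmod (ws ! j $ i))\<^sup>2)" for j
  have N: "complex_of_real (N j) = (\<Sum>i<n. cnj (ws ! j $ i) * ws ! j $ i)" for j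
    by (simp add: N_def complex_norm_square mult.commute del: of_real_power)
  have Npos: "N j > 0" if "j < n" for j
  proof -
    have "N j \<noteq> 0" using orth[OF that that] N[of j] by auto
    moreover have "N j \<ge> 0" unfolding N_def by (intro sum_nonneg) auto
    ultimately show ?thesis by simp
  qed
  \<comment> \<open>Gram-Schmidt keeps v as first vector but does not normalise; dividing by the
    norms turns orthogonal columns into orthonormal ones.\<close>
  define W where "W = mat n n (\<lambda>(i,j). ws ! j $ i / complex_of_real (sqrt (N j)))"
  have W: "W \<in> carrier_mat n n" by (simp add: W_def)
  have "cadj W * W = 1\<^sub>m n"
  proof (rule eq_matI)
    fix k j assume "k < dim_row (1\<^sub>m n)" "j < dim_col (1\<^sub>m n :: complex mat)"
    then have kj: "k < n" "j < n" by auto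
    have "(cadj W * W) $$ (k,j) = (\<Sum>i<n. cnj (W $$ (i,k)) * W $$ (i,j))"
      using W kj by (subst index_mult_mat_sum[of _ n n _ n]) auto
    also have "\<dots> = (\<Sum>i<n. cnj (ws ! k $ i) * ws ! j $ i) / (sqrt (N k) * sqrt (N j))"
      using kj by (simp add: W_def sum_divide_distrib)
    also have "\<dots> = 1\<^sub>m n $$ (k,j)"
    proof (cases "j = k")
      case True
      have "N k / (sqrt (N k) * sqrt (N k)) = 1" using Npos[OF kj(1)] by simp
      then have "complex_of_real (N k) / (complex_of_real (sqrt (N k)) * complex_of_real (sqrt (N k))) = 1"
        by (simp only: of_real_1 flip: of_real_mult of_real_divide)
      then show ?thesis using kj by (simp only: True N[symmetric] index_one_mat if_True of_real_mult simp_thms)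
    next
      case False
      then show ?thesis using orth[OF kj(2,1)] kj by simp
    qed
    finally show "(cadj W * W) $$ (k,j) = 1\<^sub>m n $$ (k,j)" .
  qed (use W in \<open>auto simp: cadj_def\<close>)
  then have "unitary_mat n W" using W by (rule unitary_matI[rotated])
  moreover have "col W 0 = complex_of_real (1 / sqrt (N 0)) \<cdot>\<^sub>v v"
  proof -
    have "ws ! 0 = v" using n hdws ws(3) by (cases ws) auto
    then show ?thesis using n v by (intro eq_vecI) (auto simp: W_def)
  qed
  moreover have "complex_of_real (1 / sqrt (N 0)) \<noteq> 0" using Npos[of 0] n by simp
  ultimately show ?thesis by blast
qed

lemma block_diag_mult:
  fixes A B C D :: "'a :: semiring_1 mat"
  assumes [simp]: "A \<in> carrier_mat m m" "B \<in> carrier_mat m m" "C \<in> carrier_mat n n" "D \<in> carrier_mat n n"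
  shows "four_block_mat A (0\<^sub>m m n) (0\<^sub>m n m) C * four_block_mat B (0\<^sub>m m n) (0\<^sub>m n m) D
    = four_block_mat (A * B) (0\<^sub>m m n) (0\<^sub>m n m) (C * D)"
  by (subst mult_four_block_mat[of _ m m _ n _ n _ _ m _ n])
    (auto simp: left_mult_zero_mat[of D n n] left_mult_zero_mat[of B m m]
      right_mult_zero_mat[of A m m] right_mult_zero_mat[of C n n])

text \<open>Deflation: an eigenvector, available over the complex numbers, becomes the first column
  of a unitary W. The first column of W^* A W is then a multiple of the first unit vector; Hermitian
  symmetry clears the first row and makes e real, and the remaining block falls under the induction
  hypothesis.\<close>

lemma hermitian_diagonalization:
  assumes "A \<in> carrier_mat n n" "cadj A = A"
  shows "\<exists>U d. unitary_mat n U \<and> A = U * real_diag_mat n d * cadj U"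
  using assms
proof (induction n arbitrary: A)
  case 0
  then show ?case
    by (intro exI[of _ "1\<^sub>m 0"] exI[of _ "\<lambda>_. 0"] conjI unitary_one eq_matI) auto
next
  case (Suc n)
  note A = Suc.prems(1)
  let ?N = "Suc n"
  obtain e v where "eigenvector A v e"
    using spectrum_non_empty[OF A] by (auto simp: spectrum_def eigenvalue_def)
  then have v: "v \<in> carrier_vec ?N" "v \<noteq> 0\<^sub>v ?N" "A *\<^sub>v v = e \<cdot>\<^sub>v v"
    using A by (auto simp: eigenvector_def)
  obtain W c where W: "unitary_mat ?N W" and c: "col W 0 = c \<cdot>\<^sub>v v"
    using unitary_first_column[OF v(1,2)] by blast
  note [simp] = unitary_matD[OF W] A
  define M where "M = cadj W * (A * W)"
  have M [simp]: "M \<in> carrier_mat ?N ?N" unfolding M_def by auto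
  have M_herm: "cadj M = M"
    unfolding M_def using Suc.prems(2)
    by (simp add: cadj_mult[of _ ?N ?N _ ?N] assoc_mult_mat[of _ ?N ?N _ ?N _ ?N])
  have AM: "A = W * (M * cadj W)"
  proof -
    have "W * (M * cadj W) = W * (cadj W * (A * (W * cadj W)))"
      unfolding M_def by (simp add: assoc_mult_mat[of _ ?N ?N _ ?N _ ?N] del: unitary_matD(3)[OF W])
    also have "\<dots> = A * (W * cadj W)" by (rule cancel_mult_mat[of _ _ ?N _ ?N]) auto
    finally show ?thesis by (simp add: right_mult_one_mat[OF A])
  qed
  have AW0: "(A * W) $$ (i,0) = e * W $$ (i,0)" if "i < ?N" for i
  proof -
    have "(A * W) $$ (i,0) = (A *\<^sub>v col W 0) $ i" using that by (auto simp: carrier_matD[OF A] carrier_matD[OF unitary_matD(1)[OF W]])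
    also have "\<dots> = (e \<cdot>\<^sub>v col W 0) $ i"
      using v A by (simp add: c mult_mat_vec[OF A v(1)] smult_smult_assoc mult.commute)
    finally show ?thesis using that unitary_matD(1)[OF W] by (simp add: carrier_matD[OF unitary_matD(1)[OF W]])
  qed
  have M0: "M $$ (k,0) = (if k = 0 then e else 0)" if "k < ?N" for k
  proof -
    have "M $$ (k,0) = (\<Sum>i<?N. cadj W $$ (k,i) * (A * W) $$ (i,0))"
      unfolding M_def using that by (subst index_mult_mat_sum[of _ ?N ?N _ ?N]) auto
    also have "\<dots> = (\<Sum>i<?N. cadj W $$ (k,i) * (e * W $$ (i,0)))"
      by (intro sum.cong refl arg_cong2[of _ _ _ _ "(*)"]) (auto simp: AW0)
    also have "\<dots> = e * (\<Sum>i<?N. cadj W $$ (k,i) * W $$ (i,0))"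
      by (simp add: sum_distrib_left ac_simps del: sum.lessThan_Suc)
    also have "(\<Sum>i<?N. cadj W $$ (k,i) * W $$ (i,0)) = (cadj W * W) $$ (k,0)"
      using that by (subst index_mult_mat_sum[of _ ?N ?N _ ?N]) auto
    also have "\<dots> = 1\<^sub>m ?N $$ (k,0)" by simp
    finally show ?thesis using that by simp
  qed
  have Msym: "M $$ (i,j) = cnj (M $$ (j,i))" if "i < ?N" "j < ?N" for i j
    using M_herm M that by (metis cadj_index carrier_matD)
  have M0': "M $$ (0,k) = (if k = 0 then e else 0)" if "k < ?N" for k
    using Msym[of 0 k] M0[of k] M0[of 0] Msym[of 0 0] that by auto
  have e: "e = complex_of_real (Re e)"
    using Msym[of 0 0] M0[of 0] by (simp add: complex_eq_iff)
  define A' where "A' = mat n n (\<lambda>(i,j). M $$ (Suc i, Suc j))"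
  have A'[simp]: "A' \<in> carrier_mat n n" by (simp add: A'_def)
  have "cadj A' = A'"
    by (rule eq_matI) (auto simp: A'_def cadj_def intro!: Msym[symmetric])
  from Suc.IH[OF A' this] obtain U' d' where U': "unitary_mat n U'" 
    and A'eq: "A' = U' * real_diag_mat n d' * cadj U'" by blast
  note [simp] = unitary_matD[OF U']
  define P where "P = four_block_mat (1\<^sub>m 1) (0\<^sub>m 1 n) (0\<^sub>m n 1) U'"
  define d where "d i = (case i of 0 \<Rightarrow> Re e | Suc i \<Rightarrow> d' i)" for i
  have P [simp]: "P \<in> carrier_mat ?N ?N"
    using four_block_carrier_mat[of "1\<^sub>m 1" 1 1 U' n n] by (simp add: P_def)
  have cP: "cadj P = four_block_mat (1\<^sub>m 1) (0\<^sub>m 1 n) (0\<^sub>m n 1) (cadj U')"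
    by (rule eq_matI) (auto simp: P_def cadj_def carrier_matD[OF unitary_matD(1)[OF U']])
  have D: "real_diag_mat ?N d = four_block_mat (e \<cdot>\<^sub>m 1\<^sub>m 1) (0\<^sub>m 1 n) (0\<^sub>m n 1) (real_diag_mat n d')"
    by (rule eq_matI) (use e in \<open>auto simp: real_diag_mat_def d_def split: nat.splits\<close>)
  have Mblock: "M = four_block_mat (e \<cdot>\<^sub>m 1\<^sub>m 1) (0\<^sub>m 1 n) (0\<^sub>m n 1) A'"
    by (rule eq_matI) (use M M0 M0' in \<open>auto simp: A'_def carrier_matD[OF M]\<close>)
  have "cadj P * P = 1\<^sub>m ?N"
    unfolding cP unfolding P_def
    by (subst block_diag_mult[of _ 1 _ _ n]) (auto simp: four_block_one_mat)
  then have P_un: "unitary_mat ?N P" by (intro unitary_matI) auto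
  have MP: "M = P * real_diag_mat ?N d * cadj P"
    unfolding cP D Mblock A'eq unfolding P_def
    by (simp add: block_diag_mult[of _ 1 _ _ n] del: One_nat_def)
  have "A = (W * P) * real_diag_mat ?N d * cadj (W * P)"
    unfolding AM MP
    by (simp add: cadj_mult[of _ ?N ?N _ ?N] assoc_mult_mat[of _ ?N ?N _ ?N _ ?N])
  with unitary_mult[OF W P_un] show ?case by blast
qed

declare One_nat_def [simp del]

section \<open>Functional calculus in a fixed eigenbasis\<close>

lemma unitary_diag_mult:
  assumes "unitary_mat n U"
  shows "(U * real_diag_mat n d * cadj U) * (U * real_diag_mat n e * cadj U)
    = U * real_diag_mat n (\<lambda>i. d i * e i) * cadj U"
proof -
  note [simp] = unitary_matD[OF assms]
  have "(U * real_diag_mat n d * cadj U) * (U * real_diag_mat n e * cadj U)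
      = U * (real_diag_mat n d * (cadj U * (U * (real_diag_mat n e * cadj U))))"
    by (simp add: assoc_mult_mat[of _ n n _ n _ n])
  also have "cadj U * (U * (real_diag_mat n e * cadj U)) = real_diag_mat n e * cadj U"
    by (rule cancel_mult_mat[of _ _ n _ n]) auto
  also have "U * (real_diag_mat n d * (real_diag_mat n e * cadj U))
      = U * ((real_diag_mat n d * real_diag_mat n e) * cadj U)"
    by (simp only: assoc_mult_mat[of "real_diag_mat n d" n n "real_diag_mat n e" n "cadj U" n]
        real_diag_carrier cadj_carrier unitary_matD[OF assms])
  finally show ?thesis
    by (simp add: real_diag_mult assoc_mult_mat[of _ n n _ n _ n])
qed

lemma unitary_diag_one:
  assumes "unitary_mat n U" "\<And>i. i < n \<Longrightarrow> d i = 1"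
  shows "U * real_diag_mat n d * cadj U = 1\<^sub>m n"
  using unitary_matD[OF assms(1)] by (simp add: real_diag_one[OF assms(2)] right_mult_one_mat[of U n])

lemma spectral_cadj:
  assumes "spectral n A U d"
  shows "cadj A = A"
proof -
  note [simp] = spectralD(5)[OF assms]
  have "cadj A = cadj (U * real_diag_mat n d * cadj U)"
    by (simp flip: spectralD(3)[OF assms])
  also have "\<dots> = U * real_diag_mat n d * cadj U"
    by (simp add: cadj_mult[of _ n n _ n] assoc_mult_mat[of _ n n _ n _ n])
  finally show ?thesis by (simp flip: spectralD(3)[OF assms])
qed

lemma spectral_left_inverse:
  assumes "spectral n A U d"
  shows "\<exists>A' \<in> carrier_mat n n. A' * A = 1\<^sub>m n"
proof
  note [simp] = spectralD(5)[OF assms]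
  show "U * real_diag_mat n (\<lambda>i. 1 / d i) * cadj U \<in> carrier_mat n n" by simp
  show "U * real_diag_mat n (\<lambda>i. 1 / d i) * cadj U * A = 1\<^sub>m n"
    using spectralD(2)[OF assms]
    by (subst spectralD(3)[OF assms], subst unitary_diag_mult[OF spectralD(1)[OF assms]],
        intro unitary_diag_one[OF spectralD(1)[OF assms]]) force
qed

section \<open>Quadratic forms and positive definiteness, with vectors treated as one-column
  matrices\<close>

lemma quadratic_form_col:
  fixes v :: "complex vec"
  assumes A: "A \<in> carrier_mat n n" and v: "v \<in> carrier_vec n"
  defines "Y \<equiv> mat n 1 (\<lambda>(i,_). v $ i)"
  shows "conjugate v \<bullet> (A *\<^sub>v v) = (cadj Y * A * Y) $$ (0,0)"
proof -
  have Y [simp]: "Y \<in> carrier_mat n 1" by (simp add: Y_def)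
  have cY: "col Y 0 = v" using v by (intro eq_vecI) (auto simp: Y_def)
  have "(cadj Y * A * Y) $$ (0,0) = (cadj Y * (A * Y)) $$ (0,0)"
    using A by (simp add: assoc_mult_mat[of _ 1 n _ n _ 1])
  also have "\<dots> = (\<Sum>l<n. cadj Y $$ (0,l) * (A * Y) $$ (l,0))"
    using A by (intro index_mult_mat_sum[of _ 1 n _ 1] mult_carrier_mat[of _ n n]) auto
  also have "\<dots> = (\<Sum>l<n. cnj (v $ l) * (A *\<^sub>v v) $ l)"
  proof (intro sum.cong refl arg_cong2[of _ _ _ _ "(*)"])
    fix l assume "l \<in> {..<n}"
    then show "cadj Y $$ (0,l) = cnj (v $ l)" "(A * Y) $$ (l,0) = (A *\<^sub>v v) $ l"
      using A v carrier_matD[OF Y] by (simp_all add: cY, simp add: Y_def)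
  qed
  also have "\<dots> = conjugate v \<bullet> (A *\<^sub>v v)"
    using A v by (simp add: scalar_prod_def lessThan_atLeast0)
  finally show ?thesis by simp
qed

lemma pos_def_congruence:
  assumes Z: "Z \<in> carrier_mat n n" and Z': "Z' \<in> carrier_mat n n" "Z' * Z = 1\<^sub>m n"
    and d: "\<And>i. i < n \<Longrightarrow> 0 < d i"
  shows "cadj Z * real_diag_mat n d * Z \<in> pos_def_mats n"
  unfolding pos_def_mats_def
proof (intro CollectI conjI ballI impI)
  note [simp] = Z
  show carr: "cadj Z * real_diag_mat n d * Z \<in> carrier_mat n n" by simp
  show "cadj (cadj Z * real_diag_mat n d * Z) = cadj Z * real_diag_mat n d * Z"
    by (simp add: cadj_mult[of _ n n _ n] assoc_mult_mat[of _ n n _ n _ n])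
  fix v :: "complex vec" assume v: "v \<in> carrier_vec n" "v \<noteq> 0\<^sub>v n"
  define Y where "Y = mat n 1 (\<lambda>(i,_). v $ i)"
  have Y [simp]: "Y \<in> carrier_mat n 1" by (simp add: Y_def)
  have ZY [simp]: "Z * Y \<in> carrier_mat n 1" by (rule mult_carrier_mat[OF Z Y])
  have "conjugate v \<bullet> ((cadj Z * real_diag_mat n d * Z) *\<^sub>v v)
      = (cadj Y * (cadj Z * real_diag_mat n d * Z) * Y) $$ (0,0)"
    unfolding Y_def by (rule quadratic_form_col[OF carr v(1)])
  also have "cadj Y * (cadj Z * real_diag_mat n d * Z) * Y = cadj (Z * Y) * real_diag_mat n d * (Z * Y)"
    by (simp add: cadj_mult[of Z n n Y 1] assoc_mult_mat[of _ 1 n _ n _ 1] assoc_mult_mat[of _ 1 n _ n _ n]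
        assoc_mult_mat[of _ n n _ n _ 1] assoc_mult_mat[of _ n n _ n _ n] mult_carrier_mat[of _ 1 n _ n]
        mult_carrier_mat[of _ n n _ 1])
  also have "\<dots> $$ (0,0) = complex_of_real (\<Sum>i<n. d i * (cmod ((Z * Y) $$ (i,0)))\<^sup>2)"
    by (rule quadratic_form_diag[of _ _ 1]) auto
  finally have eq: "Re (conjugate v \<bullet> ((cadj Z * real_diag_mat n d * Z) *\<^sub>v v))
      = (\<Sum>i<n. d i * (cmod ((Z * Y) $$ (i,0)))\<^sup>2)" by simp
  have "\<exists>i<n. (Z * Y) $$ (i,0) \<noteq> 0"
  proof (rule ccontr)
    assume "\<not> ?thesis"
    then have "Z * Y = 0\<^sub>m n 1" using carrier_matD[OF Z] carrier_matD[OF Y]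
      by (intro eq_matI) (auto simp del: index_mult_mat(1))
    moreover have "Z' * (Z * Y) = Y" by (rule cancel_mult_mat[of _ _ n _ 1]) (use Z' Z Y in auto)
    ultimately have "Y = 0\<^sub>m n 1" using Z' by simp
    then have "Y $$ (i,0) = 0" if "i < n" for i using that by simp
    then have "v = 0\<^sub>v n" using v(1) by (intro eq_vecI) (auto simp: Y_def)
    with v(2) show False by simp
  qed
  then obtain i where i: "i < n" "(Z * Y) $$ (i,0) \<noteq> 0" by blast
  have "0 < (\<Sum>i<n. d i * (cmod ((Z * Y) $$ (i,0)))\<^sup>2)"
    by (rule sum_pos2[of _ i]) (use i d in \<open>auto intro!: mult_nonneg_nonneg less_imp_le[OF d]\<close>)
  then show "0 < Re (conjugate v \<bullet> ((cadj Z * real_diag_mat n d * Z) *\<^sub>v v))" by (simp only: eq)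
qed

lemma spectral_imp_pos_def:
  assumes "spectral n A U d"
  shows "A \<in> pos_def_mats n"
  using pos_def_congruence[of "cadj U" n U d] spectralD(2)[OF assms] unitary_matD[OF spectralD(1)[OF assms]]
  by (simp flip: spectralD(3)[OF assms])

lemma pos_def_imp_spectral:
  assumes "A \<in> pos_def_mats n"
  shows "\<exists>U d. spectral n A U d"
proof -
  have A: "A \<in> carrier_mat n n" "cadj A = A"
    and pos: "\<And>v. v \<in> carrier_vec n \<Longrightarrow> v \<noteq> 0\<^sub>v n \<Longrightarrow> 0 < Re (conjugate v \<bullet> (A *\<^sub>v v))"
    using assms by (auto simp: pos_def_mats_def)
  obtain U d where U: "unitary_mat n U" and Ad: "A = U * real_diag_mat n d * cadj U"
    using hermitian_diagonalization[OF A] by blast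
  note [simp] = unitary_matD[OF U]
  have "0 < d i" if i: "i < n" for i
  proof -
    \<comment> \<open>The i-th eigenvector is the test vector: there the quadratic form equals
      \<open>d i\<close>.\<close>
    define v where "v = col U i"
    define Y where "Y = mat n 1 (\<lambda>(i,_). v $ i)"
    have Y [simp]: "Y \<in> carrier_mat n 1" by (simp add: Y_def)
    have v: "v \<in> carrier_vec n" using i unitary_matD(1)[OF U] by (auto simp: v_def)
    have UY: "(cadj U * Y) $$ (l,0) = (if l = i then 1 else 0)" if l: "l < n" for l
    proof -
      have "(cadj U * Y) $$ (l,0) = (\<Sum>k<n. cadj U $$ (l,k) * Y $$ (k,0))"
        using l by (intro index_mult_mat_sum[of _ n n _ 1]) auto
      also have "\<dots> = (\<Sum>k<n. cadj U $$ (l,k) * U $$ (k,i))"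
        using i by (intro sum.cong) (auto simp: Y_def v_def carrier_matD[OF unitary_matD(1)[OF U]])
      also have "\<dots> = (cadj U * U) $$ (l,i)"
        using l i by (intro index_mult_mat_sum[symmetric, of _ n n _ n]) auto
      finally show ?thesis using l i by simp
    qed
    have "v \<noteq> 0\<^sub>v n"
    proof
      assume "v = 0\<^sub>v n"
      then have "Y = 0\<^sub>m n 1" by (intro eq_matI) (auto simp: Y_def)
      then have "(cadj U * Y) $$ (i,0) = 0" using i by (simp add: right_mult_zero_mat[of _ n n])
      with UY[OF i] show False by simp
    qed
    note pos[OF v this]
    also have "conjugate v \<bullet> (A *\<^sub>v v) = (cadj Y * A * Y) $$ (0,0)"
      unfolding Y_def by (rule quadratic_form_col[OF A(1) v])
    also have "cadj Y * A * Y = cadj (cadj U * Y) * real_diag_mat n d * (cadj U * Y)"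
      unfolding Ad
      by (simp add: cadj_mult[of _ n n Y 1] assoc_mult_mat[of _ 1 n _ n _ 1] assoc_mult_mat[of _ 1 n _ n _ n]
        assoc_mult_mat[of _ n n _ n _ 1] assoc_mult_mat[of _ n n _ n _ n] mult_carrier_mat[of _ 1 n _ n]
        mult_carrier_mat[of _ n n _ 1])
    also have "\<dots> $$ (0,0) = complex_of_real (\<Sum>l<n. d l * (cmod ((cadj U * Y) $$ (l,0)))\<^sup>2)"
      by (rule quadratic_form_diag[of _ _ 1]) (auto intro: mult_carrier_mat[of _ n n])
    also have "(\<Sum>l<n. d l * (cmod ((cadj U * Y) $$ (l,0)))\<^sup>2) = (\<Sum>l<n. if l = i then d i else 0)"
      by (intro sum.cong) (auto simp: UY simp del: index_mult_mat(1))
    finally show ?thesis using i by simp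
  qed
  then show ?thesis using U Ad by (auto simp: spectral_def)
qed

lemma smult_mat_mult_vec:
  fixes A :: "'a :: comm_ring_1 mat"
  assumes "dim_vec v = dim_col A"
  shows "(c \<cdot>\<^sub>m A) *\<^sub>v v = c \<cdot>\<^sub>v (A *\<^sub>v v)"
  by (rule eq_vecI) (use assms in \<open>auto simp: scalar_prod_def sum_distrib_left mult.assoc\<close>)

lemma pos_def_convex:
  assumes A: "A \<in> pos_def_mats n" and B: "B \<in> pos_def_mats n" and t: "0 \<le> t" "t \<le> 1"
  shows "complex_of_real t \<cdot>\<^sub>m A + complex_of_real (1 - t) \<cdot>\<^sub>m B \<in> pos_def_mats n"
  unfolding pos_def_mats_def
proof (intro CollectI conjI ballI impI)
  have c: "A \<in> carrier_mat n n" "B \<in> carrier_mat n n" "cadj A = A" "cadj B = B"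
    using A B by (auto simp: pos_def_mats_def)
  show "complex_of_real t \<cdot>\<^sub>m A + complex_of_real (1 - t) \<cdot>\<^sub>m B \<in> carrier_mat n n" using c by simp
  show "cadj (complex_of_real t \<cdot>\<^sub>m A + complex_of_real (1 - t) \<cdot>\<^sub>m B)
      = complex_of_real t \<cdot>\<^sub>m A + complex_of_real (1 - t) \<cdot>\<^sub>m B"
    using c by (subst cadj_add[of _ n n]) (auto simp: cadj_smult_real simp del: of_real_diff)
  fix v :: "complex vec" assume v: "v \<in> carrier_vec n" "v \<noteq> 0\<^sub>v n"
  have cv: "conjugate v \<in> carrier_vec n" using v by simp
  have "(complex_of_real t \<cdot>\<^sub>m A + complex_of_real (1 - t) \<cdot>\<^sub>m B) *\<^sub>v v
      = complex_of_real t \<cdot>\<^sub>v (A *\<^sub>v v) + complex_of_real (1 - t) \<cdot>\<^sub>v (B *\<^sub>v v)"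
    using c v by (simp add: add_mult_distrib_mat_vec[of _ n n] smult_mat_mult_vec)
  also have "conjugate v \<bullet> \<dots> = complex_of_real t * (conjugate v \<bullet> (A *\<^sub>v v))
      + complex_of_real (1 - t) * (conjugate v \<bullet> (B *\<^sub>v v))"
    using c v cv by (simp add: scalar_prod_add_distrib[of _ n] scalar_prod_smult_distrib[of _ n])
  finally have "Re (conjugate v \<bullet> ((complex_of_real t \<cdot>\<^sub>m A + complex_of_real (1 - t) \<cdot>\<^sub>m B) *\<^sub>v v))
      = t * Re (conjugate v \<bullet> (A *\<^sub>v v)) + (1 - t) * Re (conjugate v \<bullet> (B *\<^sub>v v))" by simp
  moreover have "0 < Re (conjugate v \<bullet> (A *\<^sub>v v))" "0 < Re (conjugate v \<bullet> (B *\<^sub>v v))"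
    using A B v by (auto simp: pos_def_mats_def)
  then have "0 < t * Re (conjugate v \<bullet> (A *\<^sub>v v)) + (1 - t) * Re (conjugate v \<bullet> (B *\<^sub>v v))"
    using t by (cases "t = 0") (auto intro: add_pos_nonneg)
  ultimately show "0 < Re (conjugate v \<bullet> ((complex_of_real t \<cdot>\<^sub>m A + complex_of_real (1 - t) \<cdot>\<^sub>m B) *\<^sub>v v))"
    by simp
qed

lemma spectral_iff:
  "spectral n A U d \<longleftrightarrow> U \<in> carrier_mat n n \<and> cadj U * U = 1\<^sub>m n \<and>
    (\<forall>i<n. 0 < d i) \<and> A = U * real_diag_mat n d * cadj U"
  using unitary_matI[of U n] unitary_matD[of n U] by (auto simp only: spectral_def)

text \<open>Recovers a decomposition that witnesses the choice made by \<open>mat_powr\<close>. It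
  may vary with r, hence the existential form.\<close>

lemma mat_powr_spectral:
  assumes "A \<in> pos_def_mats n"
  shows "\<exists>U d. spectral n A U d \<and> mat_powr A r = U * real_diag_mat n (\<lambda>i. d i powr r) * cadj U"
proof -
  have n: "dim_row A = n" using assms by (auto simp: pos_def_mats_def)
  define Q where "Q M U d \<longleftrightarrow> spectral n A U d \<and> M = U * real_diag_mat n (\<lambda>i. d i powr r) * cadj U" for M U d
  have "mat_powr A r = (SOME M. \<exists>U d. Q M U d)"
    by (simp only: mat_powr_def n Q_def spectral_iff conj_assoc)
  moreover obtain U d where "spectral n A U d" using pos_def_imp_spectral[OF assms] by blast
  then have "\<exists>M U d. Q M U d" unfolding Q_def by blast
  from someI_ex[OF this] have "\<exists>U d. Q (SOME M. \<exists>U d. Q M U d) U d" .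
  ultimately show ?thesis by (simp add: Q_def)
qed

text \<open>The eigenvectors of \<open>Y Y\<^sup>*\<close> are the columns of \<open>Y W \<Lambda>\<^sup>-\<^sup>1\<^sup>/\<^sup>2\<close>.\<close>

lemma spectral_mult_cadj_swap:
  assumes Y: "Y \<in> carrier_mat n n" and sp: "spectral n (cadj Y * Y) W l"
  shows "\<exists>V. spectral n (Y * cadj Y) V l"
proof -
  note [simp] = Y spectralD(5)[OF sp]
  note W = spectralD(1)[OF sp]
  define R where "R = real_diag_mat n (\<lambda>i. l i powr (-1/2))"
  define V where "V = Y * (W * R)"
  have R [simp]: "R \<in> carrier_mat n n" "cadj R = R" by (simp_all add: R_def)
  have V [simp]: "V \<in> carrier_mat n n" by (simp add: V_def)
  have l: "l i powr (-1/2) * (l i * l i powr (-1/2)) = 1" if "i < n" for i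
  proof -
    have "l i powr (-1/2) * (l i powr 1 * l i powr (-1/2)) = l i powr (-1/2 + (1 + (-1/2)))"
      by (simp only: powr_add)
    then show ?thesis using spectralD(2)[OF sp that] by simp
  qed
  have RlR: "R * (real_diag_mat n l * R) = 1\<^sub>m n"
    unfolding R_def real_diag_mult by (rule real_diag_one) (rule l)
  have mid: "cadj Y * (Y * (W * R)) = W * (real_diag_mat n l * R)"
  proof -
    have "cadj Y * (Y * (W * R)) = cadj Y * Y * (W * R)"
      by (simp add: assoc_mult_mat[of _ n n _ n _ n])
    also have "\<dots> = W * (real_diag_mat n l * (cadj W * (W * R)))"
      by (subst spectralD(3)[OF sp]) (simp add: assoc_mult_mat[of _ n n _ n _ n])
    also have "cadj W * (W * R) = R" by (rule cancel_mult_mat[of _ _ n _ n]) (simp_all add: unitary_matD[OF W])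
    finally show ?thesis .
  qed
  have "cadj V * V = R * (cadj W * (cadj Y * (Y * (W * R))))"
    by (simp add: V_def cadj_mult[of _ n n _ n] assoc_mult_mat[of _ n n _ n _ n])
  also have "\<dots> = R * (cadj W * (W * (real_diag_mat n l * R)))" by (simp only: mid)
  also have "cadj W * (W * (real_diag_mat n l * R)) = real_diag_mat n l * R"
    by (rule cancel_mult_mat[of _ _ n _ n]) (simp_all add: unitary_matD[OF W])
  finally have "cadj V * V = 1\<^sub>m n" by (simp only: RlR)
  then have VU: "unitary_mat n V" by (intro unitary_matI) auto
  have RRl: "R * (real_diag_mat n l * (R * (cadj W * cadj Y))) = cadj W * cadj Y"
  proof -
    have "R * (real_diag_mat n l * (R * (cadj W * cadj Y))) = R * (real_diag_mat n l * R) * (cadj W * cadj Y)"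
      by (simp add: assoc_mult_mat[of _ n n _ n _ n])
    then show ?thesis by (simp add: RlR left_mult_one_mat[of _ n n])
  qed
  have "V * real_diag_mat n l * cadj V = Y * (W * (R * (real_diag_mat n l * (R * (cadj W * cadj Y)))))"
    by (simp add: V_def cadj_mult[of _ n n _ n] assoc_mult_mat[of _ n n _ n _ n])
  also have "\<dots> = Y * (W * (cadj W * cadj Y))" by (simp only: RRl)
  also have "W * (cadj W * cadj Y) = cadj Y"
    by (rule cancel_mult_mat[of _ _ n _ n]) (simp_all add: unitary_matD[OF W])
  finally have "Y * cadj Y = V * real_diag_mat n l * cadj V" by simp
  then show ?thesis using VU spectralD(2)[OF sp] unfolding spectral_def by blast
qed

text \<open>With M = A^(q/2) and Y = B M, the matrix under the trace is Y^* Y, while Y Y^* = B A^q B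
  has the same eigenvalues. In the second form B stands outside as a plain linear factor, ready for
  the quadratic form in K.\<close>

lemma Phi_2_spectral:
  assumes A: "A \<in> pos_def_mats n" and B: "B \<in> pos_def_mats n"
  shows "\<exists>U \<alpha> V l. spectral n A U \<alpha>
    \<and> spectral n (B * (U * real_diag_mat n (\<lambda>i. \<alpha> i powr q) * cadj U) * B) V l
    \<and> Phi 2 q s A B = (\<Sum>i<n. l i powr s)"
proof -
  define M where "M = mat_powr A (q/2)"
  obtain U \<alpha> where U: "spectral n A U \<alpha>"
    and M: "M = U * real_diag_mat n (\<lambda>i. \<alpha> i powr (q/2)) * cadj U"
    using mat_powr_spectral[OF A] M_def by blast
  have spM: "spectral n M U (\<lambda>i. \<alpha> i powr (q/2))"
    using U M unfolding spectral_def by force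
  have MM: "M * M = U * real_diag_mat n (\<lambda>i. \<alpha> i powr q) * cadj U"
    unfolding M unitary_diag_mult[OF spectralD(1)[OF U]]
    by (simp flip: powr_add)
  obtain V0 \<beta> where spB: "spectral n B V0 \<beta>" 
    and B2: "mat_powr B 2 = V0 * real_diag_mat n (\<lambda>i. \<beta> i powr 2) * cadj V0"
    using mat_powr_spectral[OF B] by blast
  \<comment> \<open>The exponent 2 gives the honest square \<open>B * B\<close>, so the
    decomposition chosen for B disappears.\<close>
  have "real_diag_mat n (\<lambda>i. \<beta> i powr 2) = real_diag_mat n (\<lambda>i. \<beta> i * \<beta> i)"
    using spectralD(2)[OF spB] by (intro real_diag_cong) (simp add: power2_eq_square less_imp_le)
  then have BB: "mat_powr B 2 = B * B"
    unfolding B2 by (subst (1 2) spectralD(3)[OF spB]) (simp add: unitary_diag_mult[OF spectralD(1)[OF spB]])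
  note [simp] = spectralD(4)[OF spB] spectralD(4)[OF spM] spectral_cadj[OF spB] spectral_cadj[OF spM]
  define Y where "Y = B * M"
  have Y [simp]: "Y \<in> carrier_mat n n" by (simp add: Y_def)
  have cY: "cadj Y = M * B" by (simp add: Y_def cadj_mult[of _ n n _ n])
  have X: "M * mat_powr B 2 * M = cadj Y * Y"
    unfolding cY BB by (simp add: Y_def assoc_mult_mat[of _ n n _ n _ n])
  obtain B' where B': "B' \<in> carrier_mat n n" "B' * B = 1\<^sub>m n" using spectral_left_inverse[OF spB] by blast
  obtain M' where M': "M' \<in> carrier_mat n n" "M' * M = 1\<^sub>m n" using spectral_left_inverse[OF spM] by blast
  have inv: "M' * B' * Y = 1\<^sub>m n"
  proof -
    have "M' * B' * Y = M' * (B' * (B * M))" using B' M' by (simp add: Y_def assoc_mult_mat[of _ n n _ n _ n])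
    also have "B' * (B * M) = M" by (rule cancel_mult_mat[of _ _ n _ n]) (use B' in auto)
    finally show ?thesis using M' by simp
  qed
  \<comment> \<open>Y is a product of invertible matrices, so Y^* Y is a congruence of the identity,
    written as a diagonal matrix of ones.\<close>
  have "cadj Y * real_diag_mat n (\<lambda>_. 1) * Y \<in> pos_def_mats n"
    by (rule pos_def_congruence[of _ _ "M' * B'"]) (use inv M' B' in auto)
  then have "cadj Y * Y \<in> pos_def_mats n"
    by (simp add: real_diag_one right_mult_one_mat[of _ n n])
  from mat_powr_spectral[OF this] obtain W l where W: "spectral n (cadj Y * Y) W l"
    and Xs: "mat_powr (cadj Y * Y) s = W * real_diag_mat n (\<lambda>i. l i powr s) * cadj W" by blast
  have "Phi 2 q s A B = (\<Sum>i<n. l i powr s)"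
    unfolding Phi_def M_def[symmetric] X Xs ctrace_cong_unitary[OF spectralD(1)[OF W] real_diag_carrier]
    by (simp only: ctrace_real_diag Re_complex_of_real)
  moreover have "Y * cadj Y = B * (M * M) * B"
    unfolding cY by (simp add: Y_def assoc_mult_mat[of _ n n _ n _ n])
  then have "Y * cadj Y = B * (U * real_diag_mat n (\<lambda>i. \<alpha> i powr q) * cadj U) * B"
    by (simp only: MM)
  moreover obtain V where "spectral n (Y * cadj Y) V l" using spectral_mult_cadj_swap[OF Y W] by blast
  ultimately show ?thesis using U by metis
qed

section \<open>A power mean as a mixture of resolvents\<close>

lemma integrable_exp_mscale_atLeast:
  fixes m :: real
  assumes "0 < m"
  shows "integrable lborel (\<lambda>v. indicator {0..} v * exp (- m * v))"
proof -
  have "(\<lambda>v. exp (- m * v)) absolutely_integrable_on {0..}"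
    by (rule nonnegative_absolutely_integrable_1)
      (use has_integral_exp_minus_to_infinity[OF assms, of 0] in auto)
  then have "integrable lebesgue (\<lambda>v. indicator {0..} v * exp (- m * v))"
    by (simp add: set_integrable_def)
  then show ?thesis by (subst (asm) integrable_completion) auto
qed

text \<open>Dominated by exp(-(1-a)v) on the right half line and by exp(av) on the left; both decay
  because 0 < a < 1. The left bound is the reflection of an exponential on the right, which explains
  the argument \<open>0 + -1 * v\<close>.\<close>

lemma integrable_logistic_kernel:
  fixes a :: real
  assumes a: "0 < a" "a < 1"
  shows "integrable lborel (\<lambda>v. exp (a * v) / (exp v + 1))"
proof (rule Bochner_Integration.integrable_bound)
  have "integrable lborel (\<lambda>v. indicator {0..} (0 + -1 * v) * exp (- a * (0 + -1 * v)) :: real)"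
    by (rule lborel_integrable_real_affine[OF integrable_exp_mscale_atLeast[OF a(1)]]) simp
  moreover have "integrable lborel (\<lambda>v. indicator {0..} v * exp (- (1 - a) * v) :: real)"
    by (rule integrable_exp_mscale_atLeast) (use a in simp)
  ultimately show "integrable lborel (\<lambda>v. indicator {0..} v * exp (- (1 - a) * v)
      + indicator {0..} (0 + -1 * v) * exp (- a * (0 + -1 * v)) :: real)"
    by (rule Bochner_Integration.integrable_add[rotated])
  show "AE v in lborel. norm (exp (a * v) / (exp v + 1)) \<le> norm (indicator {0..} v * exp (- (1 - a) * v)
      + indicator {0..} (0 + -1 * v) * exp (- a * (0 + -1 * v)) :: real)"
  proof (rule AE_I2)
    fix v :: real
    have p: "0 < exp v + 1" by (simp add: add_pos_pos)
    show "norm (exp (a * v) / (exp v + 1)) \<le> norm (indicator {0..} v * exp (- (1 - a) * v)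
      + indicator {0..} (0 + -1 * v) * exp (- a * (0 + -1 * v)) :: real)"
    proof (cases "v \<ge> 0")
      case True
      have "exp (a * v) / (exp v + 1) \<le> exp (a * v) / exp v"
        by (intro divide_left_mono) (auto simp: add_pos_pos)
      also have "\<dots> = exp (- (1 - a) * v)" by (simp add: algebra_simps flip: exp_diff)
      finally show ?thesis using True p by (auto simp: indicator_def)
    next
      case False
      have "exp (a * v) / (exp v + 1) \<le> exp (a * v) / 1"
        by (intro divide_left_mono) (auto simp: add_pos_pos)
      then show ?thesis using False p by (auto simp: indicator_def)
    qed
  qed
qed simp

text \<open>In logarithmic coordinates the homogeneity of the kernel becomes translation invariance,
  so the value of the integral for \<open>x = y = 1\<close> is never needed.\<close>

lemma resolvent_mixture:
  fixes a :: real
  assumes a: "0 < a" "a < 1"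
  obtains c where "0 < c"
    "\<And>x y. 0 < x \<Longrightarrow> 0 < y \<Longrightarrow> integrable lborel (\<lambda>v. exp (a * v) / (exp v * x + 1 * y))"
    "\<And>x y. 0 < x \<Longrightarrow> 0 < y \<Longrightarrow>
      (LINT v|lborel. exp (a * v) / (exp v * x + 1 * y)) = c * (x powr (-a) * y powr (a - 1))"
proof
  define f where "f v = exp (a * v) / (exp v + 1)" for v :: real
  have f: "integrable lborel f" unfolding f_def by (rule integrable_logistic_kernel[OF a])
  have fpos: "0 < f v" for v by (simp add: f_def add_pos_pos)
  show "0 < (LINT v|lborel. f v)"
  proof -
    have "(LINT v|lborel. f v) \<noteq> 0"
    proof
      assume "(LINT v|lborel. f v) = 0"
      \<comment> \<open>A strictly positive function cannot vanish almost everywhere, since the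
        whole line is not a null set.\<close>
      then have "AE v in lborel. f v = 0"
        using integral_nonneg_eq_0_iff_AE[OF f] fpos by (simp add: less_imp_le)
      then have "AE v in (lborel :: real measure). False"
        by eventually_elim (use fpos in \<open>auto simp: less_le\<close>)
      then show False by (simp add: eventually_False ae_filter_eq_bot_iff)
    qed
    moreover have "0 \<le> (LINT v|lborel. f v)" by (intro Bochner_Integration.integral_nonneg) (auto simp: less_imp_le[OF fpos])
    ultimately show ?thesis by simp
  qed
  fix x y :: real assume xy: "0 < x" "0 < y"
  \<comment> \<open>The shift: exp v * x / y = exp (z + v), so the kernel at (x, y) is a translate
    of \<open>f\<close> up to a factor.\<close>
  define z where "z = ln x - ln y"
  have eq: "exp (a * v) / (exp v * x + 1 * y) = (x powr (-a) * y powr (a - 1)) * f (z + 1 * v)" for v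
  proof -
    have "exp (z + v) = exp v * x / y" using xy by (simp add: z_def exp_add exp_diff)
    moreover have "exp (a * (z + v)) = exp (a * v) * (x powr a * y powr (-a))"
      using xy by (simp add: z_def powr_def flip: exp_add) (simp add: algebra_simps)
    ultimately have "f (z + v) = exp (a * v) * (x powr a * y powr (-a)) / ((exp v * x + y) / y)"
      using xy by (simp add: f_def add_divide_distrib)
    then have "(x powr (-a) * y powr (a - 1)) * f (z + v)
      = (x powr (-a) * x powr a) * ((y powr (a - 1) * y powr (- a)) * y) * exp (a * v) / (exp v * x + y)"
      by simp
    also have "x powr (-a) * x powr a = 1" using xy by (simp flip: powr_add)
    also have "y powr (a - 1) * y powr (- a) = 1 / y" using xy by (simp add: powr_diff powr_minus_divide)
    finally show ?thesis using xy by simp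
  qed
  show "integrable lborel (\<lambda>v. exp (a * v) / (exp v * x + 1 * y))"
    unfolding eq by (intro integrable_mult_right lborel_integrable_real_affine[OF f]) simp
  have "(LINT v|lborel. f v) = (LINT v|lborel. f (z + 1 * v))"
    by (subst lborel_integral_real_affine[of 1 f z]) auto
  then show "(LINT v|lborel. exp (a * v) / (exp v * x + 1 * y))
      = (LINT v|lborel. f v) * (x powr (-a) * y powr (a - 1))"
    unfolding eq by simp
qed

section \<open>Joint convexity of the weighted quadratic forms\<close>

text \<open>With \<open>A = U diag(\<alpha>) U\<^sup>*\<close>, \<open>C = W diag(\<gamma>) W\<^sup>*\<close> and \<open>g x y = x powr p * y powr r\<close>,
  this is \<open>Tr (K\<^sup>* A\<^sup>p K C\<^sup>r)\<close>.\<close>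

definition weighted_form ::
  "nat \<Rightarrow> (real \<Rightarrow> real \<Rightarrow> real) \<Rightarrow> complex mat \<Rightarrow> complex mat \<Rightarrow> (nat \<Rightarrow> real) \<Rightarrow> complex mat \<Rightarrow> (nat \<Rightarrow> real) \<Rightarrow> real"
  where "weighted_form n g K U \<alpha> W \<gamma> =
    (\<Sum>j<n. \<Sum>i<n. (cmod ((cadj U * K * W) $$ (i,j)))\<^sup>2 * g (\<alpha> i) (\<gamma> j))"

text \<open>The resolvent form is the supremum over \<open>Z\<close> of these expressions, which for fixed \<open>Z\<close>
  are affine in \<open>(A, K, C)\<close>; this is what makes it jointly convex.\<close>

definition affine_form :: "real \<Rightarrow> real \<Rightarrow> complex mat \<Rightarrow> complex mat \<Rightarrow> complex mat \<Rightarrow> complex mat \<Rightarrow> real" where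
  "affine_form \<tau> \<sigma> Z A K C = 2 * Re (ctrace (cadj Z * K)) - \<tau> * Re (ctrace (cadj Z * A * Z))
    - \<sigma> * Re (ctrace (Z * C * cadj Z))"

lemma affine_form_convex_combination:
  assumes [simp]: "Z \<in> carrier_mat n n" "A1 \<in> carrier_mat n n" "A2 \<in> carrier_mat n n"
    "K1 \<in> carrier_mat n n" "K2 \<in> carrier_mat n n" "C1 \<in> carrier_mat n n" "C2 \<in> carrier_mat n n"
  shows "affine_form \<tau> \<sigma> Z (complex_of_real t \<cdot>\<^sub>m A1 + complex_of_real u \<cdot>\<^sub>m A2)
      (complex_of_real t \<cdot>\<^sub>m K1 + complex_of_real u \<cdot>\<^sub>m K2)
      (complex_of_real t \<cdot>\<^sub>m C1 + complex_of_real u \<cdot>\<^sub>m C2)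
    = t * affine_form \<tau> \<sigma> Z A1 K1 C1 + u * affine_form \<tau> \<sigma> Z A2 K2 C2"
proof -
  have lin: "P * (complex_of_real t \<cdot>\<^sub>m X + complex_of_real u \<cdot>\<^sub>m Y)
      = complex_of_real t \<cdot>\<^sub>m (P * X) + complex_of_real u \<cdot>\<^sub>m (P * Y)"
    "(complex_of_real t \<cdot>\<^sub>m X + complex_of_real u \<cdot>\<^sub>m Y) * P
      = complex_of_real t \<cdot>\<^sub>m (X * P) + complex_of_real u \<cdot>\<^sub>m (Y * P)"
    if [simp]: "P \<in> carrier_mat n n" "X \<in> carrier_mat n n" "Y \<in> carrier_mat n n" for P X Y
    by (simp_all add: mult_add_distrib_mat[of _ n n _ n] add_mult_distrib_mat[of _ n n _ _ n]
        mult_smult_distrib[of _ n n _ n] mult_smult_assoc_mat[of _ n n _ n])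
  show ?thesis
    by (simp add: affine_form_def lin ctrace_add[of _ n] ctrace_smult[of _ n]) (simp add: algebra_simps)
qed

lemma ctrace_quadratic_form_diag:
  assumes "z \<in> carrier_mat n n"
  shows "Re (ctrace (cadj z * real_diag_mat n \<alpha> * z)) = (\<Sum>j<n. \<Sum>i<n. \<alpha> i * (cmod (z $$ (i,j)))\<^sup>2)"
    "Re (ctrace (z * real_diag_mat n \<gamma> * cadj z)) = (\<Sum>j<n. \<Sum>i<n. \<gamma> j * (cmod (z $$ (i,j)))\<^sup>2)"
proof -
  have "Re (ctrace (cadj z * real_diag_mat n \<alpha> * z)) = (\<Sum>j<n. Re ((cadj z * real_diag_mat n \<alpha> * z) $$ (j,j)))"
    using assms by (simp add: ctrace_def cadj_def)
  also have "\<dots> = (\<Sum>j<n. \<Sum>i<n. \<alpha> i * (cmod (z $$ (i,j)))\<^sup>2)"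
    using assms by (intro sum.cong refl) (simp only: quadratic_form_diag[of z n n] lessThan_iff Re_complex_of_real)
  finally show "Re (ctrace (cadj z * real_diag_mat n \<alpha> * z)) = (\<Sum>j<n. \<Sum>i<n. \<alpha> i * (cmod (z $$ (i,j)))\<^sup>2)" .
  have "Re (ctrace (z * real_diag_mat n \<gamma> * cadj z)) = (\<Sum>i<n. Re ((z * real_diag_mat n \<gamma> * cadj z) $$ (i,i)))"
    using assms by (simp add: ctrace_def cadj_def)
  also have "\<dots> = (\<Sum>i<n. \<Sum>j<n. \<gamma> j * (cmod (cadj z $$ (j,i)))\<^sup>2)"
    using assms quadratic_form_diag[of "cadj z" n n]
    by (intro sum.cong refl) (simp only: cadj_carrier cadj_cadj lessThan_iff Re_complex_of_real)
  also have "\<dots> = (\<Sum>i<n. \<Sum>j<n. \<gamma> j * (cmod (z $$ (i,j)))\<^sup>2)"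
    using assms by (intro sum.cong refl) auto
  finally show "Re (ctrace (z * real_diag_mat n \<gamma> * cadj z)) = (\<Sum>j<n. \<Sum>i<n. \<gamma> j * (cmod (z $$ (i,j)))\<^sup>2)"
    by (subst sum.swap)
qed

lemma ctrace_cadj_mult:
  assumes "z \<in> carrier_mat n n" "k \<in> carrier_mat n n"
  shows "ctrace (cadj z * k) = (\<Sum>j<n. \<Sum>i<n. cnj (z $$ (i,j)) * k $$ (i,j))"
proof -
  have "ctrace (cadj z * k) = (\<Sum>j<n. (cadj z * k) $$ (j,j))"
    using assms by (simp add: ctrace_def cadj_def)
  also have "\<dots> = (\<Sum>j<n. \<Sum>i<n. cadj z $$ (j,i) * k $$ (i,j))"
    using assms by (intro sum.cong refl index_mult_mat_sum[of _ n n _ n]) auto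
  also have "\<dots> = (\<Sum>j<n. \<Sum>i<n. cnj (z $$ (i,j)) * k $$ (i,j))"
    using assms by (intro sum.cong refl) auto
  finally show ?thesis .
qed

text \<open>In the coordinates Z = U z W^* cyclicity removes U and W from all three traces. What is
  left separates into one independent quadratic expression per entry of z, so the supremum over Z
  can be taken entrywise.\<close>

lemma affine_form_spectral:
  assumes A: "spectral n A U \<alpha>" and C: "spectral n C W \<gamma>"
    and K: "K \<in> carrier_mat n n" and z: "z \<in> carrier_mat n n"
  defines "k \<equiv> cadj U * K * W"
  shows "affine_form \<tau> \<sigma> (U * z * cadj W) A K C = (\<Sum>j<n. \<Sum>i<n.
    2 * Re (cnj (z $$ (i,j)) * k $$ (i,j)) - (\<tau> * \<alpha> i + \<sigma> * \<gamma> j) * (cmod (z $$ (i,j)))\<^sup>2)"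
proof -
  note [simp] = K z
  note U = unitary_matD[OF spectralD(1)[OF A]] and W = unitary_matD[OF spectralD(1)[OF C]]
  note [simp] = U(1) W(1)
  note assoc = assoc_mult_mat[of _ n n _ n _ n]
  have k [simp]: "k \<in> carrier_mat n n" by (simp add: k_def)
  have UU: "cadj U * (U * X) = X" "cadj W * (W * X) = X" if "X \<in> carrier_mat n n" for X
    by (rule cancel_mult_mat[of _ _ n _ n]; use U W that in simp)+
  have "cadj (U * z * cadj W) * K = W * (cadj z * (cadj U * K))"
    by (simp add: cadj_mult[of _ n n _ n] assoc)
  moreover have "ctrace (W * (cadj z * (cadj U * K))) = ctrace (cadj z * (cadj U * K) * W)"
    by (rule ctrace_comm[of _ n n]) auto
  ultimately have t1: "ctrace (cadj (U * z * cadj W) * K) = ctrace (cadj z * k)"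
    by (simp add: k_def assoc)
  have "cadj (U * z * cadj W) * A * (U * z * cadj W) = W * (cadj z * real_diag_mat n \<alpha> * z) * cadj W"
    by (simp add: spectralD(3)[OF A] cadj_mult[of _ n n _ n] assoc UU)
  then have t2: "ctrace (cadj (U * z * cadj W) * A * (U * z * cadj W)) = ctrace (cadj z * real_diag_mat n \<alpha> * z)"
    using ctrace_cong_unitary[OF spectralD(1)[OF C]] by simp
  have "(U * z * cadj W) * C * cadj (U * z * cadj W) = U * (z * real_diag_mat n \<gamma> * cadj z) * cadj U"
    by (simp add: spectralD(3)[OF C] cadj_mult[of _ n n _ n] assoc UU)
  then have t3: "ctrace ((U * z * cadj W) * C * cadj (U * z * cadj W)) = ctrace (z * real_diag_mat n \<gamma> * cadj z)"
    using ctrace_cong_unitary[OF spectralD(1)[OF A]] by simp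
  show ?thesis
    unfolding affine_form_def t1 t2 t3 ctrace_quadratic_form_diag[OF z] ctrace_cadj_mult[OF z k]
    by (simp add: sum_subtractf sum.distrib sum_distrib_left algebra_simps)
qed

text \<open>Expand |r z - k|^2 >= 0 and divide by r. Equality holds at z = k / r.\<close>

lemma complex_square_completion:
  fixes z k :: complex
  assumes "0 < r"
  shows "2 * Re (cnj z * k) - r * (cmod z)\<^sup>2 \<le> (cmod k)\<^sup>2 * (1 / r)"
proof -
  have "0 \<le> (cmod (complex_of_real r * z - k))\<^sup>2" by simp
  also have "\<dots> = r\<^sup>2 * (cmod z)\<^sup>2 - 2 * r * Re (cnj z * k) + (cmod k)\<^sup>2"
    by (simp add: cmod_power2) (simp add: power2_eq_square algebra_simps)
  finally have "r * (2 * Re (cnj z * k) - r * (cmod z)\<^sup>2) \<le> (cmod k)\<^sup>2"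
    by (simp add: power2_eq_square algebra_simps)
  then show ?thesis using assms by (simp add: field_simps)
qed

lemma affine_form_le_resolvent:
  assumes A: "spectral n A U \<alpha>" and C: "spectral n C W \<gamma>"
    and K: "K \<in> carrier_mat n n" and Z: "Z \<in> carrier_mat n n" and "0 < \<tau>" "0 \<le> \<sigma>"
  shows "affine_form \<tau> \<sigma> Z A K C \<le> weighted_form n (\<lambda>x y. 1 / (\<tau> * x + \<sigma> * y)) K U \<alpha> W \<gamma>"
proof -
  note U = unitary_matD[OF spectralD(1)[OF A]] and W = unitary_matD[OF spectralD(1)[OF C]]
  note [simp] = U(1) W(1) Z
  define z where "z = cadj U * Z * W"
  have z: "z \<in> carrier_mat n n" by (simp add: z_def)
  have "U * z * cadj W = U * (cadj U * (Z * (W * cadj W)))"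
    by (simp add: z_def assoc_mult_mat[of _ n n _ n _ n] del: W(3))
  also have "\<dots> = Z * (W * cadj W)" by (rule cancel_mult_mat[of _ _ n _ n]) (simp_all add: U)
  also have "\<dots> = Z" by (simp add: W right_mult_one_mat[of _ n n])
  finally have Zz: "Z = U * z * cadj W" by simp
  show ?thesis
    unfolding Zz affine_form_spectral[OF A C K z] weighted_form_def
    using spectralD(2)[OF A] spectralD(2)[OF C] assms(5,6)
    by (intro sum_mono complex_square_completion add_pos_nonneg) (auto simp: less_imp_le)
qed

lemma resolvent_eq_affine_form:
  assumes A: "spectral n A U \<alpha>" and C: "spectral n C W \<gamma>"
    and K: "K \<in> carrier_mat n n" and "0 < \<tau>" "0 \<le> \<sigma>"
  shows "\<exists>Z \<in> carrier_mat n n.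
    weighted_form n (\<lambda>x y. 1 / (\<tau> * x + \<sigma> * y)) K U \<alpha> W \<gamma> = affine_form \<tau> \<sigma> Z A K C"
proof -
  note [simp] = spectralD(5)[OF A] spectralD(5)[OF C]
  define k where "k = cadj U * K * W"
  \<comment> \<open>The entrywise maximiser of the completed square.\<close>
  define z where "z = mat n n (\<lambda>(i,j). k $$ (i,j) / complex_of_real (\<tau> * \<alpha> i + \<sigma> * \<gamma> j))"
  have z [simp]: "z \<in> carrier_mat n n" by (simp add: z_def)
  have "2 * Re (cnj (z $$ (i,j)) * k $$ (i,j)) - (\<tau> * \<alpha> i + \<sigma> * \<gamma> j) * (cmod (z $$ (i,j)))\<^sup>2
      = (cmod (k $$ (i,j)))\<^sup>2 * (1 / (\<tau> * \<alpha> i + \<sigma> * \<gamma> j))" if "i < n" "j < n" for i j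
  proof -
    define r where "r = \<tau> * \<alpha> i + \<sigma> * \<gamma> j"
    have r: "r > 0" unfolding r_def using spectralD(2)[OF A] spectralD(2)[OF C] assms(4,5) that
      by (intro add_pos_nonneg) (auto simp: less_imp_le)
    have zz: "z $$ (i,j) = k $$ (i,j) / complex_of_real r" using that by (simp add: z_def r_def)
    have "cnj (z $$ (i,j)) * k $$ (i,j) = complex_of_real ((cmod (k $$ (i,j)))\<^sup>2 / r)"
      unfolding zz by (simp add: complex_norm_square mult.commute del: of_real_power)
    then have "Re (cnj (z $$ (i,j)) * k $$ (i,j)) = (cmod (k $$ (i,j)))\<^sup>2 / r"
      by (simp only: Re_complex_of_real)
    moreover have "(cmod (z $$ (i,j)))\<^sup>2 = (cmod (k $$ (i,j)))\<^sup>2 / r\<^sup>2"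
      unfolding zz by (simp add: norm_divide power_divide)
    ultimately show ?thesis using r unfolding r_def[symmetric] by (simp add: field_simps power2_eq_square)
  qed
  then have "weighted_form n (\<lambda>x y. 1 / (\<tau> * x + \<sigma> * y)) K U \<alpha> W \<gamma> = affine_form \<tau> \<sigma> (U * z * cadj W) A K C"
    unfolding affine_form_spectral[OF A C K z] weighted_form_def k_def[symmetric] by simp
  moreover have "U * z * cadj W \<in> carrier_mat n n" by simp
  ultimately show ?thesis by blast
qed

definition convex_combination_mat ::
  "nat \<Rightarrow> real \<Rightarrow> complex mat \<Rightarrow> complex mat \<Rightarrow> complex mat \<Rightarrow> bool" where
  "convex_combination_mat n t X X1 X2 \<longleftrightarrow> X1 \<in> carrier_mat n n \<and> X2 \<in> carrier_mat n n
    \<and> X = complex_of_real t \<cdot>\<^sub>m X1 + complex_of_real (1 - t) \<cdot>\<^sub>m X2"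

text \<open>The Z attaining the supremum at the combined point is a competitor at both end points.
  The parameter \<sigma> is 1 for the resolvents of the mixture and 0 for the endpoint a =
  1.\<close>

lemma weighted_form_resolvent_convex:
  assumes A: "spectral n A U \<alpha>" "spectral n A1 U1 \<alpha>1" "spectral n A2 U2 \<alpha>2"
      "convex_combination_mat n t A A1 A2"
    and C: "spectral n C W \<gamma>" "spectral n C1 W1 \<gamma>1" "spectral n C2 W2 \<gamma>2"
      "convex_combination_mat n t C C1 C2"
    and K: "convex_combination_mat n t K K1 K2"
    and t: "0 \<le> t" "t \<le> 1" and "0 < \<tau>" "0 \<le> \<sigma>"
  defines "g \<equiv> \<lambda>x y. 1 / (\<tau> * x + \<sigma> * y)"
  shows "weighted_form n g K U \<alpha> W \<gamma>
    \<le> t * weighted_form n g K1 U1 \<alpha>1 W1 \<gamma>1 + (1 - t) * weighted_form n g K2 U2 \<alpha>2 W2 \<gamma>2"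
proof -
  have Kc: "K \<in> carrier_mat n n" "K1 \<in> carrier_mat n n" "K2 \<in> carrier_mat n n"
    using K by (auto simp: convex_combination_mat_def)
  obtain Z where Z: "Z \<in> carrier_mat n n" "weighted_form n g K U \<alpha> W \<gamma> = affine_form \<tau> \<sigma> Z A K C"
    using resolvent_eq_affine_form[OF A(1) C(1) Kc(1) assms(12,13)] unfolding g_def by blast
  note Z(2)
  also have "affine_form \<tau> \<sigma> Z A K C = t * affine_form \<tau> \<sigma> Z A1 K1 C1 + (1 - t) * affine_form \<tau> \<sigma> Z A2 K2 C2"
    using A(4) C(4) K affine_form_convex_combination[OF Z(1), of A1 A2 K1 K2 C1 C2 \<tau> \<sigma> t "1 - t"]
    by (simp add: convex_combination_mat_def)
  also have "\<dots> \<le> t * weighted_form n g K1 U1 \<alpha>1 W1 \<gamma>1 + (1 - t) * weighted_form n g K2 U2 \<alpha>2 W2 \<gamma>2"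
    unfolding g_def using t assms(12,13) Z(1) Kc A C
    by (intro add_mono mult_left_mono affine_form_le_resolvent) auto
  finally show ?thesis .
qed

text \<open>The mixture applied to each entry. The constant c is fixed before the matrices, so it
  cancels when three forms are compared.\<close>

lemma weighted_form_powr_integral:
  fixes a :: real and n :: nat
  assumes a: "0 < a" "a < 1"
  obtains c where "0 < c"
    "\<And>K U \<alpha> W \<gamma>. (\<And>i. i < n \<Longrightarrow> 0 < \<alpha> i) \<Longrightarrow> (\<And>i. i < n \<Longrightarrow> 0 < \<gamma> i) \<Longrightarrow>
      integrable lborel (\<lambda>v. exp (a * v) * weighted_form n (\<lambda>x y. 1 / (exp v * x + 1 * y)) K U \<alpha> W \<gamma>)"
    "\<And>K U \<alpha> W \<gamma>. (\<And>i. i < n \<Longrightarrow> 0 < \<alpha> i) \<Longrightarrow> (\<And>i. i < n \<Longrightarrow> 0 < \<gamma> i) \<Longrightarrow>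
      (LINT v|lborel. exp (a * v) * weighted_form n (\<lambda>x y. 1 / (exp v * x + 1 * y)) K U \<alpha> W \<gamma>)
      = c * weighted_form n (\<lambda>x y. x powr (-a) * y powr (a - 1)) K U \<alpha> W \<gamma>"
proof -
  obtain c where c: "0 < c"
    and int: "\<And>x y. 0 < x \<Longrightarrow> 0 < y \<Longrightarrow> integrable lborel (\<lambda>v. exp (a * v) / (exp v * x + 1 * y))"
    and val: "\<And>x y. 0 < x \<Longrightarrow> 0 < y \<Longrightarrow>
      (LINT v|lborel. exp (a * v) / (exp v * x + 1 * y)) = c * (x powr (-a) * y powr (a - 1))"
    using resolvent_mixture[OF a] by blast
  have eq: "exp (a * v) * weighted_form n (\<lambda>x y. 1 / (exp v * x + 1 * y)) K U \<alpha> W \<gamma>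
      = (\<Sum>j<n. \<Sum>i<n. (cmod ((cadj U * K * W) $$ (i,j)))\<^sup>2 * (exp (a * v) / (exp v * \<alpha> i + 1 * \<gamma> j)))"
    for v K U \<alpha> W \<gamma>
    by (simp add: weighted_form_def sum_distrib_left ac_simps)
  show ?thesis
  proof (rule that[OF c])
    fix K U :: "complex mat" and \<alpha> :: "nat \<Rightarrow> real" and W and \<gamma> :: "nat \<Rightarrow> real"
    assume pos: "\<And>i. i < n \<Longrightarrow> 0 < \<alpha> i" "\<And>i. i < n \<Longrightarrow> 0 < \<gamma> i"
    have int': "integrable lborel (\<lambda>v. (cmod ((cadj U * K * W) $$ (i,j)))\<^sup>2 * (exp (a * v) / (exp v * \<alpha> i + 1 * \<gamma> j)))"
      if "i < n" "j < n" for i j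
      by (intro integrable_mult_right int pos that)
    show "integrable lborel (\<lambda>v. exp (a * v) * weighted_form n (\<lambda>x y. 1 / (exp v * x + 1 * y)) K U \<alpha> W \<gamma>)"
      unfolding eq by (intro Bochner_Integration.integrable_sum int') auto
    have "(LINT v|lborel. exp (a * v) * weighted_form n (\<lambda>x y. 1 / (exp v * x + 1 * y)) K U \<alpha> W \<gamma>)
      = (\<Sum>j<n. (LINT v|lborel. (\<Sum>i<n. (cmod ((cadj U * K * W) $$ (i,j)))\<^sup>2 * (exp (a * v) / (exp v * \<alpha> i + 1 * \<gamma> j)))))"
      unfolding eq by (intro Bochner_Integration.integral_sum Bochner_Integration.integrable_sum int') auto
    also have "\<dots> = (\<Sum>j<n. \<Sum>i<n. (LINT v|lborel. (cmod ((cadj U * K * W) $$ (i,j)))\<^sup>2 * (exp (a * v) / (exp v * \<alpha> i + 1 * \<gamma> j))))"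
      by (intro sum.cong refl Bochner_Integration.integral_sum int') auto
    also have "\<dots> = (\<Sum>j<n. \<Sum>i<n. (cmod ((cadj U * K * W) $$ (i,j)))\<^sup>2 * (c * (\<alpha> i powr (-a) * \<gamma> j powr (a - 1))))"
      by (intro sum.cong refl) (simp only: integral_mult_right_zero val pos lessThan_iff)
    also have "\<dots> = c * weighted_form n (\<lambda>x y. x powr (-a) * y powr (a - 1)) K U \<alpha> W \<gamma>"
      by (simp add: weighted_form_def sum_distrib_left ac_simps)
    finally show "(LINT v|lborel. exp (a * v) * weighted_form n (\<lambda>x y. 1 / (exp v * x + 1 * y)) K U \<alpha> W \<gamma>)
      = c * weighted_form n (\<lambda>x y. x powr (-a) * y powr (a - 1)) K U \<alpha> W \<gamma>" .
  qed
qed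

text \<open>Lieb's joint convexity: the resolvent inequality holds for each v and is integrated
  against the positive weight exp(av).\<close>

lemma weighted_form_powr_convex:
  assumes A: "spectral n A U \<alpha>" "spectral n A1 U1 \<alpha>1" "spectral n A2 U2 \<alpha>2"
      "convex_combination_mat n t A A1 A2"
    and C: "spectral n C W \<gamma>" "spectral n C1 W1 \<gamma>1" "spectral n C2 W2 \<gamma>2"
      "convex_combination_mat n t C C1 C2"
    and K: "convex_combination_mat n t K K1 K2"
    and t: "0 \<le> t" "t \<le> 1" and a: "0 < a" "a \<le> 1"
  defines "g \<equiv> \<lambda>x y. x powr (-a) * y powr (a - 1)"
  shows "weighted_form n g K U \<alpha> W \<gamma>
    \<le> t * weighted_form n g K1 U1 \<alpha>1 W1 \<gamma>1 + (1 - t) * weighted_form n g K2 U2 \<alpha>2 W2 \<gamma>2"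
proof (cases "a = 1")
  case True
  \<comment> \<open>At a = 1 the mixture kernel stops being integrable, but the function is then
    itself a resolvent, 1/x. Positivity of \<open>\<gamma> j\<close> gives
    \<open>\<gamma> j powr 0 = 1\<close>.\<close>
  have "weighted_form n g K U \<alpha> W \<gamma> = weighted_form n (\<lambda>x y. 1 / (1 * x + 0 * y)) K U \<alpha> W \<gamma>"
    if "spectral n A U \<alpha>" "spectral n C W \<gamma>" for K A U \<alpha> C W \<gamma>
    unfolding weighted_form_def g_def True using spectralD(2)[OF that(1)] spectralD(2)[OF that(2)]
    by (intro sum.cong refl) (simp add: powr_minus_divide less_imp_neq[symmetric] less_imp_le)
  from this[OF A(1) C(1)] this[OF A(2) C(2)] this[OF A(3) C(3)]
  show ?thesis
    using weighted_form_resolvent_convex[OF A C K t, of 1 0] by simp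
next
  case False
  with a have a1: "a < 1" by simp
  let ?R = "\<lambda>v. weighted_form n (\<lambda>x y. 1 / (exp v * x + 1 * y))"
  obtain c where c: "0 < c"
    and int: "\<And>K U \<alpha> W \<gamma>. (\<And>i. i < n \<Longrightarrow> 0 < \<alpha> i) \<Longrightarrow> (\<And>i. i < n \<Longrightarrow> 0 < \<gamma> i) \<Longrightarrow>
      integrable lborel (\<lambda>v. exp (a * v) * ?R v K U \<alpha> W \<gamma>)"
    and val: "\<And>K U \<alpha> W \<gamma>. (\<And>i. i < n \<Longrightarrow> 0 < \<alpha> i) \<Longrightarrow> (\<And>i. i < n \<Longrightarrow> 0 < \<gamma> i) \<Longrightarrow>
      (LINT v|lborel. exp (a * v) * ?R v K U \<alpha> W \<gamma>) = c * weighted_form n g K U \<alpha> W \<gamma>"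
    using weighted_form_powr_integral[OF a(1) a1, of n, folded g_def] by blast
  note pos = spectralD(2)[OF A(1)] spectralD(2)[OF C(1)] and pos1 = spectralD(2)[OF A(2)] spectralD(2)[OF C(2)]
    and pos2 = spectralD(2)[OF A(3)] spectralD(2)[OF C(3)]
  have "c * weighted_form n g K U \<alpha> W \<gamma> = (LINT v|lborel. exp (a * v) * ?R v K U \<alpha> W \<gamma>)"
    by (rule val[symmetric]) (use pos in auto)
  also have "\<dots> \<le> (LINT v|lborel. t * (exp (a * v) * ?R v K1 U1 \<alpha>1 W1 \<gamma>1)
      + (1 - t) * (exp (a * v) * ?R v K2 U2 \<alpha>2 W2 \<gamma>2))"
  proof (intro integral_mono Bochner_Integration.integrable_add integrable_mult_right int)
    fix v :: real
    have "exp (a * v) * ?R v K U \<alpha> W \<gamma>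
      \<le> exp (a * v) * (t * ?R v K1 U1 \<alpha>1 W1 \<gamma>1 + (1 - t) * ?R v K2 U2 \<alpha>2 W2 \<gamma>2)"
      by (intro mult_left_mono weighted_form_resolvent_convex[OF A C K t]) auto
    then show "exp (a * v) * ?R v K U \<alpha> W \<gamma> \<le> t * (exp (a * v) * ?R v K1 U1 \<alpha>1 W1 \<gamma>1)
      + (1 - t) * (exp (a * v) * ?R v K2 U2 \<alpha>2 W2 \<gamma>2)"
      by (simp add: algebra_simps)
  qed (use pos pos1 pos2 in auto)
  also have "\<dots> = t * (c * weighted_form n g K1 U1 \<alpha>1 W1 \<gamma>1) + (1 - t) * (c * weighted_form n g K2 U2 \<alpha>2 W2 \<gamma>2)"
    by (subst Bochner_Integration.integral_add)
      (use pos1 pos2 in \<open>auto simp only: integral_mult_right_zero val intro!: integrable_mult_right int\<close>)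
  finally have "c * weighted_form n g K U \<alpha> W \<gamma>
      \<le> c * (t * weighted_form n g K1 U1 \<alpha>1 W1 \<gamma>1 + (1 - t) * weighted_form n g K2 U2 \<alpha>2 W2 \<gamma>2)"
    by (simp add: algebra_simps)
  then show ?thesis using c by simp
qed

section \<open>Trace inequalities of Klein type\<close>

lemma spectral_conj_diag:
  assumes X: "spectral n X V l" and Y: "Y \<in> carrier_mat n n" and j: "j < n"
  shows "(cadj Y * X * Y) $$ (j,j) = complex_of_real (\<Sum>i<n. l i * (cmod ((cadj V * Y) $$ (i,j)))\<^sup>2)"
proof -
  note [simp] = Y spectralD(5)[OF X]
  have "cadj Y * X * Y = cadj (cadj V * Y) * real_diag_mat n l * (cadj V * Y)"
    by (subst spectralD(3)[OF X]) (simp add: cadj_mult[of _ n n _ n] assoc_mult_mat[of _ n n _ n _ n])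
  then show ?thesis by (simp only: quadratic_form_diag[of "cadj V * Y" n n] mult_square_carrier
        cadj_carrier Y spectralD(5)[OF X] j)
qed

text \<open>When both eigenbases coincide the averaging weights collapse to a point mass. This
  yields the equality cases of the variational formulas.\<close>

lemma unitary_cadj_self_sum:
  assumes "unitary_mat n W" "j < n"
  shows "(\<Sum>i<n. d i * (cmod ((cadj W * W) $$ (i,j)))\<^sup>2) = d j"
proof -
  have "(\<Sum>i<n. d i * (cmod ((cadj W * W) $$ (i,j)))\<^sup>2) = (\<Sum>i<n. if i = j then d j else 0)"
    using assms by (intro sum.cong refl) (auto simp: unitary_matD)
  then show ?thesis using assms by simp
qed

text \<open>With X = B A^(-a) B, the diagonal of (ZW)^* X (ZW) is computed twice, in the eigenbasis
  of A and in that of X. The factor Z is the identity for s < 1 and carries a weight for s >=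
  1.\<close>

lemma weighted_form_powr_spectral:
  assumes U: "unitary_mat n U" and B: "B \<in> carrier_mat n n" "cadj B = B"
    and X: "spectral n (B * (U * real_diag_mat n (\<lambda>i. \<alpha> i powr (-a)) * cadj U) * B) V l"
    and Z: "Z \<in> carrier_mat n n" and W: "W \<in> carrier_mat n n"
  shows "weighted_form n (\<lambda>x y. x powr (-a) * y powr (a - 1)) (B * Z) U \<alpha> W \<gamma>
    = (\<Sum>j<n. (\<Sum>i<n. l i * (cmod ((cadj V * (Z * W)) $$ (i,j)))\<^sup>2) * \<gamma> j powr (a - 1))"
proof -
  note [simp] = unitary_matD(1)[OF U] B Z W
  let ?E = "real_diag_mat n (\<lambda>i. \<alpha> i powr (-a))"
  have eq: "(\<Sum>i<n. \<alpha> i powr (-a) * (cmod ((cadj U * (B * Z) * W) $$ (i,j)))\<^sup>2)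
      = (\<Sum>i<n. l i * (cmod ((cadj V * (Z * W)) $$ (i,j)))\<^sup>2)" if j: "j < n" for j
  proof -
    have "cadj (Z * W) * (B * (U * ?E * cadj U) * B) * (Z * W)
        = cadj (cadj U * (B * Z) * W) * ?E * (cadj U * (B * Z) * W)"
      by (simp add: cadj_mult[of _ n n _ n] assoc_mult_mat[of _ n n _ n _ n])
    moreover have "(cadj (Z * W) * (B * (U * ?E * cadj U) * B) * (Z * W)) $$ (j,j)
        = complex_of_real (\<Sum>i<n. l i * (cmod ((cadj V * (Z * W)) $$ (i,j)))\<^sup>2)"
      by (rule spectral_conj_diag[OF X _ j]) simp
    moreover have "(cadj (cadj U * (B * Z) * W) * ?E * (cadj U * (B * Z) * W)) $$ (j,j)
        = complex_of_real (\<Sum>i<n. \<alpha> i powr (-a) * (cmod ((cadj U * (B * Z) * W) $$ (i,j)))\<^sup>2)"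
      by (rule quadratic_form_diag[OF _ j]) simp
    ultimately show ?thesis by (simp only: of_real_eq_iff)
  qed
  have "weighted_form n (\<lambda>x y. x powr (-a) * y powr (a - 1)) (B * Z) U \<alpha> W \<gamma>
    = (\<Sum>j<n. (\<Sum>i<n. \<alpha> i powr (-a) * (cmod ((cadj U * (B * Z) * W) $$ (i,j)))\<^sup>2) * \<gamma> j powr (a - 1))"
    unfolding weighted_form_def sum_distrib_right by (intro sum.cong refl) (simp only: ac_simps)
  also have "\<dots> = (\<Sum>j<n. (\<Sum>i<n. l i * (cmod ((cadj V * (Z * W)) $$ (i,j)))\<^sup>2) * \<gamma> j powr (a - 1))"
    by (intro sum.cong refl) (simp only: eq lessThan_iff)
  finally show ?thesis .
qed

text \<open>The graph of x^k lies above its tangent at y; this is Young's inequality with weights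
  1/k and 1 - 1/k.\<close>

lemma powr_tangent_le:
  fixes x y k :: real
  assumes "0 < x" "0 < y" "1 \<le> k"
  shows "k * x * y powr (k - 1) - (k - 1) * y powr k \<le> x powr k"
proof -
  have "(x powr k) powr (1/k) * (y powr k) powr (1 - 1/k) \<le> (1/k) * x powr k + (1 - 1/k) * y powr k"
    using assms by (intro Youngs_inequality_0) auto
  also have "(x powr k) powr (1/k) = x" using assms by (simp add: powr_powr)
  also have "(y powr k) powr (1 - 1/k) = y powr (k - 1)" using assms by (simp add: powr_powr algebra_simps)
  finally have "k * (x * y powr (k - 1)) \<le> k * ((1/k) * x powr k + (1 - 1/k) * y powr k)"
    using assms by (intro mult_left_mono) auto
  also have "\<dots> = x powr k + (k - 1) * y powr k" using assms by (simp add: field_simps)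
  finally show ?thesis by (simp add: algebra_simps)
qed

text \<open>Young's inequality with weights s and 1 - s; the exponent of the last term is the one
  for which d cancels from the geometric mean.\<close>

lemma powr_le_weighted:
  fixes x d a s :: real
  assumes "0 < x" "0 < d" "0 < s" "s < 1"
  shows "x powr s \<le> s * (x * d powr (a - 1)) + (1 - s) * d powr (s * (1 - a) / (1 - s))"
proof -
  have "(x * d powr (a - 1)) powr s * (d powr (s * (1 - a) / (1 - s))) powr (1 - s)
      \<le> s * (x * d powr (a - 1)) + (1 - s) * d powr (s * (1 - a) / (1 - s))"
    using assms by (intro Youngs_inequality_0) auto
  also have "(x * d powr (a - 1)) powr s * (d powr (s * (1 - a) / (1 - s))) powr (1 - s)
      = x powr s * (d powr ((a - 1) * s) * d powr (s * (1 - a)))"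
    using assms by (simp add: powr_mult powr_powr)
  also have "d powr ((a - 1) * s) * d powr (s * (1 - a)) = d powr ((a - 1) * s + s * (1 - a))"
    by (simp only: powr_add)
  also have "(a - 1) * s + s * (1 - a) = 0" by (simp add: algebra_simps)
  finally show ?thesis using assms by simp
qed

lemma unitary_double_sum:
  assumes "unitary_mat n S"
  shows "(\<Sum>j<n. \<Sum>i<n. f i * (cmod (S $$ (i,j)))\<^sup>2) = (\<Sum>i<n. f i)"
    "(\<Sum>j<n. \<Sum>i<n. g j * (cmod (S $$ (i,j)))\<^sup>2) = (\<Sum>j<n. g j)"
proof -
  show "(\<Sum>j<n. \<Sum>i<n. f i * (cmod (S $$ (i,j)))\<^sup>2) = (\<Sum>i<n. f i)"
    by (subst sum.swap) (simp add: unitary_row_sum[OF assms] flip: sum_distrib_left)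
  show "(\<Sum>j<n. \<Sum>i<n. g j * (cmod (S $$ (i,j)))\<^sup>2) = (\<Sum>j<n. g j)"
    by (simp add: unitary_col_sum[OF assms] flip: sum_distrib_left)
qed

text \<open>For S = V^* W linking eigenbases of D and E this reads k Tr(D E^(k-1)) - (k-1) Tr E^k <=
  Tr D^k: tangent inequalities summed against doubly stochastic weights.\<close>

lemma klein_powr_ge_1:
  assumes S: "unitary_mat n S" and d: "\<And>i. i < n \<Longrightarrow> 0 < d i" and \<delta>: "\<And>i. i < n \<Longrightarrow> 0 < \<delta> i" and k: "1 \<le> k"
  shows "(\<Sum>j<n. k * (\<Sum>i<n. d i * (cmod (S $$ (i,j)))\<^sup>2) * \<delta> j powr (k - 1) - (k - 1) * \<delta> j powr k)
    \<le> (\<Sum>i<n. d i powr k)"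
proof -
  have "(\<Sum>j<n. k * (\<Sum>i<n. d i * (cmod (S $$ (i,j)))\<^sup>2) * \<delta> j powr (k - 1) - (k - 1) * \<delta> j powr k)
      = (\<Sum>j<n. k * (\<Sum>i<n. d i * (cmod (S $$ (i,j)))\<^sup>2) * \<delta> j powr (k - 1))
        - (\<Sum>j<n. \<Sum>i<n. (k - 1) * \<delta> j powr k * (cmod (S $$ (i,j)))\<^sup>2)"
    by (simp only: sum_subtractf unitary_double_sum(2)[OF S, of "\<lambda>j. (k - 1) * \<delta> j powr k"])
  also have "\<dots> = (\<Sum>j<n. \<Sum>i<n. (k * d i * \<delta> j powr (k - 1) - (k - 1) * \<delta> j powr k) * (cmod (S $$ (i,j)))\<^sup>2)"
    unfolding sum_distrib_left sum_distrib_right sum_subtractf[symmetric]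
    by (intro sum.cong refl) (simp add: algebra_simps)
  also have "\<dots> \<le> (\<Sum>j<n. \<Sum>i<n. d i powr k * (cmod (S $$ (i,j)))\<^sup>2)"
    by (intro sum_mono mult_right_mono powr_tangent_le d \<delta> k) auto
  also have "\<dots> = (\<Sum>i<n. d i powr k)" by (rule unitary_double_sum(1)[OF S])
  finally show ?thesis .
qed

text \<open>The same averaging, now of the weighted Young bound, gives an upper estimate of a trace
  power.\<close>

lemma klein_powr_less_1:
  assumes S: "unitary_mat n S" and d: "\<And>i. i < n \<Longrightarrow> 0 < d i" and \<delta>: "\<And>i. i < n \<Longrightarrow> 0 < \<delta> i"
    and s: "0 < s" "s < 1"
  shows "(\<Sum>i<n. d i powr s) \<le> s * (\<Sum>j<n. (\<Sum>i<n. d i * (cmod (S $$ (i,j)))\<^sup>2) * \<delta> j powr (a - 1))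
    + (1 - s) * (\<Sum>j<n. \<delta> j powr (s * (1 - a) / (1 - s)))"
proof -
  let ?k = "s * (1 - a) / (1 - s)"
  have "(\<Sum>i<n. d i powr s) = (\<Sum>j<n. \<Sum>i<n. d i powr s * (cmod (S $$ (i,j)))\<^sup>2)"
    by (rule unitary_double_sum(1)[OF S, symmetric])
  also have "\<dots> \<le> (\<Sum>j<n. \<Sum>i<n. (s * (d i * \<delta> j powr (a - 1)) + (1 - s) * \<delta> j powr ?k) * (cmod (S $$ (i,j)))\<^sup>2)"
    by (intro sum_mono mult_right_mono powr_le_weighted d \<delta> s) auto
  also have "\<dots> = s * (\<Sum>j<n. (\<Sum>i<n. d i * (cmod (S $$ (i,j)))\<^sup>2) * \<delta> j powr (a - 1))
      + (\<Sum>j<n. \<Sum>i<n. (1 - s) * \<delta> j powr ?k * (cmod (S $$ (i,j)))\<^sup>2)"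
    unfolding sum_distrib_left sum_distrib_right sum.distrib[symmetric]
    by (intro sum.cong refl) (simp add: algebra_simps)
  also have "(\<Sum>j<n. \<Sum>i<n. (1 - s) * \<delta> j powr ?k * (cmod (S $$ (i,j)))\<^sup>2) = (1 - s) * (\<Sum>j<n. \<delta> j powr ?k)"
    by (simp only: unitary_double_sum(2)[OF S, of "\<lambda>j. (1 - s) * \<delta> j powr ?k"] sum_distrib_left)
  finally show ?thesis .
qed

text \<open>In the eigenbasis of D the diagonals of D1 and D2 average to \<open>\<delta>\<close>,
  and Klein's inequality bounds both trace powers below by tangents at \<open>\<delta>\<close>. A
  tangent is affine in its argument, so the two bounds average exactly to the trace power of
  D.\<close>

lemma trace_powr_convex:
  assumes D: "spectral n D W \<delta>" "spectral n D1 V1 d1" "spectral n D2 V2 d2" "convex_combination_mat n t D D1 D2"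
    and t: "0 \<le> t" "t \<le> 1" and k: "1 \<le> k"
  shows "(\<Sum>i<n. \<delta> i powr k) \<le> t * (\<Sum>i<n. d1 i powr k) + (1 - t) * (\<Sum>i<n. d2 i powr k)"
proof -
  note W = spectralD(5)[OF D(1)]
  define x1 where "x1 j = (\<Sum>i<n. d1 i * (cmod ((cadj V1 * W) $$ (i,j)))\<^sup>2)" for j
  define x2 where "x2 j = (\<Sum>i<n. d2 i * (cmod ((cadj V2 * W) $$ (i,j)))\<^sup>2)" for j
  have \<delta>: "\<delta> j = t * x1 j + (1 - t) * x2 j" if j: "j < n" for j
  proof -
    have "complex_of_real (\<delta> j) = (cadj W * D * W) $$ (j,j)"
      by (simp only: spectral_conj_diag[OF D(1) W j] unitary_cadj_self_sum[OF spectralD(1)[OF D(1)] j])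
    also have "cadj W * D * W = complex_of_real t \<cdot>\<^sub>m (cadj W * D1 * W) + complex_of_real (1 - t) \<cdot>\<^sub>m (cadj W * D2 * W)"
      using D(4) W unfolding convex_combination_mat_def
      by (auto simp: mult_add_distrib_mat[of _ n n _ n] add_mult_distrib_mat[of _ n n _ _ n]
          mult_smult_distrib[of _ n n _ n] mult_smult_assoc_mat[of _ n n _ n] simp del: of_real_diff)
    also have "\<dots> $$ (j,j) = complex_of_real t * (cadj W * D1 * W) $$ (j,j)
        + complex_of_real (1 - t) * (cadj W * D2 * W) $$ (j,j)"
      using W j by (simp add: carrier_matD[OF W] carrier_matD[OF cadj_carrier[OF W]] del: of_real_diff index_mult_mat(1))
    also have "\<dots> = complex_of_real (t * x1 j + (1 - t) * x2 j)"
      by (simp add: spectral_conj_diag[OF D(2) W j] spectral_conj_diag[OF D(3) W j] x1_def x2_def del: index_mult_mat(1))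
    finally show ?thesis by (simp only: of_real_eq_iff)
  qed
  have kl: "(\<Sum>j<n. k * x1 j * \<delta> j powr (k - 1) - (k - 1) * \<delta> j powr k) \<le> (\<Sum>i<n. d1 i powr k)"
      "(\<Sum>j<n. k * x2 j * \<delta> j powr (k - 1) - (k - 1) * \<delta> j powr k) \<le> (\<Sum>i<n. d2 i powr k)"
    unfolding x1_def x2_def
    by (rule klein_powr_ge_1; use D k in \<open>auto intro!: unitary_mult unitary_cadj dest: spectralD(1,2)\<close>)+
  have "\<delta> j powr k = t * (k * x1 j * \<delta> j powr (k - 1) - (k - 1) * \<delta> j powr k)
      + (1 - t) * (k * x2 j * \<delta> j powr (k - 1) - (k - 1) * \<delta> j powr k)" if j: "j < n" for j
  proof -
    have p: "\<delta> j * \<delta> j powr (k - 1) = \<delta> j powr k"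
      using powr_mult_base[of "\<delta> j" "k - 1"] spectralD(2)[OF D(1) j] by simp
    have "t * (k * x1 j * \<delta> j powr (k - 1) - (k - 1) * \<delta> j powr k)
      + (1 - t) * (k * x2 j * \<delta> j powr (k - 1) - (k - 1) * \<delta> j powr k)
      = k * ((t * x1 j + (1 - t) * x2 j) * \<delta> j powr (k - 1)) - (k - 1) * \<delta> j powr k"
      by (simp add: algebra_simps)
    also have "\<dots> = k * (\<delta> j * \<delta> j powr (k - 1)) - (k - 1) * \<delta> j powr k" by (simp only: \<delta>[OF j, symmetric])
    also have "\<dots> = \<delta> j powr k" unfolding p by (simp add: algebra_simps)
    finally show ?thesis by simp
  qed
  then have "(\<Sum>j<n. \<delta> j powr k) = (\<Sum>j<n. t * (k * x1 j * \<delta> j powr (k - 1) - (k - 1) * \<delta> j powr k)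
      + (1 - t) * (k * x2 j * \<delta> j powr (k - 1) - (k - 1) * \<delta> j powr k))"
    by (intro sum.cong refl) simp
  also have "\<dots> = t * (\<Sum>j<n. k * x1 j * \<delta> j powr (k - 1) - (k - 1) * \<delta> j powr k)
      + (1 - t) * (\<Sum>j<n. k * x2 j * \<delta> j powr (k - 1) - (k - 1) * \<delta> j powr k)"
    by (simp only: sum.distrib sum_distrib_left)
  also have "\<dots> \<le> t * (\<Sum>i<n. d1 i powr k) + (1 - t) * (\<Sum>i<n. d2 i powr k)"
    using t by (intro add_mono mult_left_mono kl) auto
  finally show ?thesis .
qed

section \<open>Joint convexity\<close>

text \<open>The power A^(-a) is spelled out through the same U and \<alpha> that enter
  \<open>weighted_form\<close>, so the two agree by construction.\<close>

definition sandwich_spectral ::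
  "nat \<Rightarrow> real \<Rightarrow> complex mat \<Rightarrow> complex mat \<Rightarrow> complex mat \<Rightarrow> (nat \<Rightarrow> real) \<Rightarrow> complex mat \<Rightarrow> (nat \<Rightarrow> real) \<Rightarrow> bool"
  where "sandwich_spectral n a A B U \<alpha> V l \<longleftrightarrow> spectral n A U \<alpha> \<and> B \<in> carrier_mat n n \<and> cadj B = B
    \<and> spectral n (B * (U * real_diag_mat n (\<lambda>i. \<alpha> i powr (-a)) * cadj U) * B) V l"

lemma sandwich_spectralD:
  assumes "sandwich_spectral n a A B U \<alpha> V l"
  shows "spectral n A U \<alpha>" "B \<in> carrier_mat n n" "cadj B = B"
    "spectral n (B * (U * real_diag_mat n (\<lambda>i. \<alpha> i powr (-a)) * cadj U) * B) V l"
    "unitary_mat n V" "V \<in> carrier_mat n n" "\<And>i. i < n \<Longrightarrow> 0 < l i"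
  using assms by (auto simp: sandwich_spectral_def dest: spectralD(1,2,5))

text \<open>For \<open>X = B A\<^sup>-\<^sup>a B\<close> and any \<open>D\<close>, Young's inequality bounds \<open>Tr X\<^sup>s\<close> by
  \<open>s Tr (X D\<^sup>a\<^sup>-\<^sup>1) + (1 - s) Tr D\<^sup>k\<close> with equality for \<open>D = X\<^sup>r\<close>, \<open>r = (1 - s) / (1 - a)\<close>. The parametrisation
  by \<open>D\<close> makes both terms jointly convex in \<open>(A, B, D)\<close>: the hypothesis on \<open>s\<close> says exactly \<open>k \<ge> 1\<close>.\<close>

lemma sandwich_powr_convex_less_1:
  assumes S: "sandwich_spectral n a A B U \<alpha> V l" "sandwich_spectral n a A1 B1 U1 \<alpha>1 V1 l1"
      "sandwich_spectral n a A2 B2 U2 \<alpha>2 V2 l2"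
    and AB: "convex_combination_mat n t A A1 A2" "convex_combination_mat n t B B1 B2"
    and t: "0 \<le> t" "t \<le> 1" and a: "0 < a" and s: "s < 1" "1 / (2 - a) \<le> s" "a \<le> 1"
  shows "(\<Sum>i<n. l i powr s) \<le> t * (\<Sum>i<n. l1 i powr s) + (1 - t) * (\<Sum>i<n. l2 i powr s)"
proof -
  note D = sandwich_spectralD(1)[OF S(1)] sandwich_spectralD(1)[OF S(2)] sandwich_spectralD(1)[OF S(3)]
  have s0: "0 < s" using s by (intro less_le_trans[OF _ s(2)]) simp
  have "1 \<le> s * (2 - a)" using s by (simp add: pos_divide_le_eq)
  then have sa: "1 - s \<le> s * (1 - a)" by (simp add: algebra_simps)
  then have "0 < s * (1 - a)" using s by linarith
  \<comment> \<open>At a = 1 the bound on s would read s >= 1, so the present case forces a < 1 and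
    r is well defined.\<close>
  then have a1: "a < 1" using s0 by (simp add: zero_less_mult_iff)
  define k where "k = s * (1 - a) / (1 - s)"
  have k: "1 \<le> k" using sa s by (simp add: k_def)
  let ?g = "\<lambda>x y. x powr (-a) * y powr (a - 1)"
  define r where "r = (1 - s) / (1 - a)"
  define D1 where "D1 = V1 * real_diag_mat n (\<lambda>i. l1 i powr r) * cadj V1"
  define D2 where "D2 = V2 * real_diag_mat n (\<lambda>i. l2 i powr r) * cadj V2"
  have D1: "spectral n D1 V1 (\<lambda>i. l1 i powr r)" and D2: "spectral n D2 V2 (\<lambda>i. l2 i powr r)"
    using sandwich_spectralD(5,7)[OF S(2)] sandwich_spectralD(5,7)[OF S(3)]
    by (auto simp: spectral_def D1_def D2_def less_le)
  \<comment> \<open>The competitor at the combined point is the combination of the two end point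
    minimisers.\<close>
  define D where "D = complex_of_real t \<cdot>\<^sub>m D1 + complex_of_real (1 - t) \<cdot>\<^sub>m D2"
  have DD: "convex_combination_mat n t D D1 D2"
    using spectralD(4)[OF D1] spectralD(4)[OF D2] by (simp add: convex_combination_mat_def D_def)
  have "D \<in> pos_def_mats n"
    unfolding D_def by (intro pos_def_convex spectral_imp_pos_def[OF D1] spectral_imp_pos_def[OF D2] t)
  then obtain W \<delta> where W: "spectral n D W \<delta>" using pos_def_imp_spectral by blast
  have form: "weighted_form n ?g B U \<alpha> W \<gamma>
      = (\<Sum>j<n. (\<Sum>i<n. l i * (cmod ((cadj V * W) $$ (i,j)))\<^sup>2) * \<gamma> j powr (a - 1))"
    if "sandwich_spectral n a A B U \<alpha> V l" "W \<in> carrier_mat n n" for A B U \<alpha> V l W \<gamma>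
    using weighted_form_powr_spectral[OF spectralD(1)[OF sandwich_spectralD(1)[OF that(1)]]
        sandwich_spectralD(2-4)[OF that(1)] one_carrier_mat that(2), of \<gamma>]
      sandwich_spectralD(2)[OF that(1)] that(2)
    by (simp add: right_mult_one_mat[of _ n n] left_mult_one_mat[of _ n n])
  \<comment> \<open>Since r (a - 1) = s - 1 and r k = s, both terms equal Tr X^s at D = X^r, and the
    weights s and 1 - s recombine to it.\<close>
  have pure: "weighted_form n ?g B U \<alpha> V (\<lambda>i. l i powr r) = (\<Sum>j<n. l j powr s)"
      "(\<Sum>j<n. (l j powr r) powr k) = (\<Sum>j<n. l j powr s)"
    if S: "sandwich_spectral n a A B U \<alpha> V l" for A B U \<alpha> V l
  proof -
    have "l j * (l j powr r) powr (a - 1) = l j powr s" if "j < n" for j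
    proof -
      have "r * (a - 1) = s - 1" unfolding r_def using a1 by (simp add: field_simps)
      then show ?thesis
        using powr_mult_base[of "l j" "s - 1"] sandwich_spectralD(7)[OF S that] by (simp add: powr_powr)
    qed
    then show "weighted_form n ?g B U \<alpha> V (\<lambda>i. l i powr r) = (\<Sum>j<n. l j powr s)"
      unfolding form[OF S sandwich_spectralD(6)[OF S]]
      by (intro sum.cong refl) (simp only: unitary_cadj_self_sum[OF sandwich_spectralD(5)[OF S]] lessThan_iff)
    have "r * k = s" using a1 s by (simp add: r_def k_def)
    then show "(\<Sum>j<n. (l j powr r) powr k) = (\<Sum>j<n. l j powr s)" by (simp add: powr_powr)
  qed
  have "(\<Sum>i<n. l i powr s) \<le> s * weighted_form n ?g B U \<alpha> W \<delta> + (1 - s) * (\<Sum>j<n. \<delta> j powr k)"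
    unfolding form[OF S(1) spectralD(5)[OF W]] k_def
    by (intro klein_powr_less_1 unitary_mult unitary_cadj sandwich_spectralD(5,7)[OF S(1)] spectralD(1,2)[OF W] s0 s)
  also have "\<dots> \<le> s * (t * weighted_form n ?g B1 U1 \<alpha>1 V1 (\<lambda>i. l1 i powr r)
        + (1 - t) * weighted_form n ?g B2 U2 \<alpha>2 V2 (\<lambda>i. l2 i powr r))
      + (1 - s) * (t * (\<Sum>j<n. (l1 j powr r) powr k) + (1 - t) * (\<Sum>j<n. (l2 j powr r) powr k))"
    using s0 s
    by (intro add_mono mult_left_mono trace_powr_convex[OF W D1 D2 DD t k]
        weighted_form_powr_convex[OF D AB(1) W D1 D2 DD AB(2) t a s(3)]) auto
  also have "\<dots> = t * (\<Sum>i<n. l1 i powr s) + (1 - t) * (\<Sum>i<n. l2 i powr s)"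
    unfolding pure[OF S(2)] pure[OF S(3)] by (simp add: algebra_simps)
  finally show ?thesis .
qed

text \<open>Here \<open>Tr X\<^sup>s\<close> is the maximum over \<open>D\<close> of \<open>s Tr (X D\<^sup>s\<^sup>-\<^sup>1) - (s - 1) Tr D\<^sup>s\<close>, attained at \<open>D = X\<close>;
  the weight \<open>D\<^sup>s\<^sup>-\<^sup>1\<close> is absorbed into the linear argument \<open>K = B Z\<close>, leaving \<open>C = 1\<close>.\<close>

lemma sandwich_powr_convex_ge_1:
  assumes S: "sandwich_spectral n a A B U \<alpha> V l" "sandwich_spectral n a A1 B1 U1 \<alpha>1 V1 l1"
      "sandwich_spectral n a A2 B2 U2 \<alpha>2 V2 l2"
    and AB: "convex_combination_mat n t A A1 A2" "convex_combination_mat n t B B1 B2"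
    and t: "0 \<le> t" "t \<le> 1" and a: "0 < a" "a \<le> 1" and s: "1 \<le> s"
  shows "(\<Sum>i<n. l i powr s) \<le> t * (\<Sum>i<n. l1 i powr s) + (1 - t) * (\<Sum>i<n. l2 i powr s)"
proof -
  note D = sandwich_spectralD(1)[OF S(1)] sandwich_spectralD(1)[OF S(2)] sandwich_spectralD(1)[OF S(3)]
  let ?g = "\<lambda>x y. x powr (-a) * y powr (a - 1)"
  let ?I = "1\<^sub>m n :: complex mat"
  \<comment> \<open>Half of the exponent s - 1, because Z enters quadratically: Z Z^* = X^(s-1). Z
    is built from X at the combined point and kept for both end points.\<close>
  define R where "R = real_diag_mat n (\<lambda>i. l i powr ((s - 1) / 2))"
  define Z where "Z = V * R"
  note [simp] = sandwich_spectralD(6)[OF S(1)]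
  have R [simp]: "R \<in> carrier_mat n n" by (simp add: R_def)
  have Z [simp]: "Z \<in> carrier_mat n n" by (simp add: Z_def)
  have I: "spectral n ?I ?I (\<lambda>_. 1)"
    by (simp add: spectral_def unitary_one real_diag_one)
  have II: "convex_combination_mat n t ?I ?I ?I"
    unfolding convex_combination_mat_def by (auto intro!: eq_matI)
  have K: "convex_combination_mat n t (B * Z) (B1 * Z) (B2 * Z)"
    using AB(2) unfolding convex_combination_mat_def
    by (auto simp: add_mult_distrib_mat[of _ n n _ _ n] mult_smult_assoc_mat[of _ n n _ n] simp del: of_real_diff)
  have form: "weighted_form n ?g (B' * Z) U' \<alpha>' ?I (\<lambda>_. 1)
      = (\<Sum>j<n. (\<Sum>i<n. l' i * (cmod ((cadj V' * V) $$ (i,j)))\<^sup>2) * l j powr (s - 1))"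
    if S': "sandwich_spectral n a A' B' U' \<alpha>' V' l'" for A' B' U' \<alpha>' V' l'
  proof -
    note [simp] = sandwich_spectralD(6)[OF S']
    have e: "(cmod ((cadj V' * (Z * ?I)) $$ (i,j)))\<^sup>2 = (cmod ((cadj V' * V) $$ (i,j)))\<^sup>2 * l j powr (s - 1)"
      if ij: "i < n" "j < n" for i j
    proof -
      have "cadj V' * (Z * ?I) = cadj V' * V * R"
        by (simp add: Z_def right_mult_one_mat[of _ n n] assoc_mult_mat[of _ n n _ n _ n])
      then have "(cadj V' * (Z * ?I)) $$ (i,j) = l j powr ((s - 1) / 2) * (cadj V' * V) $$ (i,j)"
        by (simp only: R_def mult_real_diag_index[of _ n n] mult_square_carrier cadj_carrier
            sandwich_spectralD(6)[OF S'] sandwich_spectralD(6)[OF S(1)] ij)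
      then show ?thesis
        by (simp add: norm_mult power_mult_distrib power2_eq_square[of "_ powr _"] del: index_mult_mat(1) flip: powr_add)
    qed
    show ?thesis
      unfolding weighted_form_powr_spectral[OF spectralD(1)[OF sandwich_spectralD(1)[OF S']]
        sandwich_spectralD(2-4)[OF S'] Z one_carrier_mat]
      by (intro sum.cong refl) (simp add: e sum_distrib_right mult.assoc del: index_mult_mat(1))
  qed
  have "s * (\<Sum>j<n. l j powr s) = s * weighted_form n ?g (B * Z) U \<alpha> ?I (\<lambda>_. 1)"
  proof -
    have "l j powr s = (\<Sum>i<n. l i * (cmod ((cadj V * V) $$ (i,j)))\<^sup>2) * l j powr (s - 1)" if j: "j < n" for j
      using powr_mult_base[of "l j" "s - 1"] sandwich_spectralD(7)[OF S(1) j]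
      by (simp add: unitary_cadj_self_sum[OF sandwich_spectralD(5)[OF S(1)] j] del: index_mult_mat(1))
    then show ?thesis unfolding form[OF S(1)] by simp
  qed
  also have "\<dots> \<le> s * (t * weighted_form n ?g (B1 * Z) U1 \<alpha>1 ?I (\<lambda>_. 1)
      + (1 - t) * weighted_form n ?g (B2 * Z) U2 \<alpha>2 ?I (\<lambda>_. 1))"
    using s by (intro mult_left_mono weighted_form_powr_convex[OF D AB(1) I I I II K t a]) auto
  \<comment> \<open>Subtracting (s - 1) Tr X^s from both sides leaves Tr X^s on the left; on the
    right it is split with weights t and 1 - t.\<close>
  finally have "(\<Sum>j<n. l j powr s) \<le> t * (s * weighted_form n ?g (B1 * Z) U1 \<alpha>1 ?I (\<lambda>_. 1) - (s - 1) * (\<Sum>j<n. l j powr s))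
      + (1 - t) * (s * weighted_form n ?g (B2 * Z) U2 \<alpha>2 ?I (\<lambda>_. 1) - (s - 1) * (\<Sum>j<n. l j powr s))"
    by (simp add: algebra_simps)
  also have "\<dots> \<le> t * (\<Sum>i<n. l1 i powr s) + (1 - t) * (\<Sum>i<n. l2 i powr s)"
  proof -
    have "s * weighted_form n ?g (B' * Z) U' \<alpha>' ?I (\<lambda>_. 1) - (s - 1) * (\<Sum>j<n. l j powr s)
        \<le> (\<Sum>i<n. l' i powr s)" if S': "sandwich_spectral n a A' B' U' \<alpha>' V' l'" for A' B' U' \<alpha>' V' l'
    proof -
      have "(\<Sum>j<n. s * (\<Sum>i<n. l' i * (cmod ((cadj V' * V) $$ (i,j)))\<^sup>2) * l j powr (s - 1) - (s - 1) * l j powr s)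
          \<le> (\<Sum>i<n. l' i powr s)"
        by (intro klein_powr_ge_1 unitary_mult unitary_cadj sandwich_spectralD(5,7)[OF S']
            sandwich_spectralD(5,7)[OF S(1)] s)
      then show ?thesis
        unfolding form[OF S'] by (simp only: sum_subtractf sum_distrib_left[symmetric] mult.assoc)
    qed
    from this[OF S(2)] this[OF S(3)] show ?thesis
      using t by (intro add_mono mult_left_mono) auto
  qed
  finally show ?thesis .
qed

theorem theorem4p2:
  fixes q s :: real and n :: nat
  assumes "-1 \<le> q" and "q < 0" and "s \<ge> 1 / (2 + q)"
  shows "\<forall>A1 \<in> pos_def_mats n. \<forall>B1 \<in> pos_def_mats n.
         \<forall>A2 \<in> pos_def_mats n. \<forall>B2 \<in> pos_def_mats n. \<forall>t::real. 0 \<le> t \<and> t \<le> 1 \<longrightarrow>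
           Phi 2 q s (complex_of_real t \<cdot>\<^sub>m A1 + complex_of_real (1 - t) \<cdot>\<^sub>m A2)
                     (complex_of_real t \<cdot>\<^sub>m B1 + complex_of_real (1 - t) \<cdot>\<^sub>m B2)
           \<le> t * Phi 2 q s A1 B1 + (1 - t) * Phi 2 q s A2 B2"
proof (intro ballI allI impI)
  fix A1 B1 A2 B2 and t :: real
  assume pd: "A1 \<in> pos_def_mats n" "B1 \<in> pos_def_mats n" "A2 \<in> pos_def_mats n" "B2 \<in> pos_def_mats n"
    and t: "0 \<le> t \<and> t \<le> 1"
  define a where "a = - q"
  have a: "0 < a" "a \<le> 1" "1 / (2 - a) \<le> s" using assms by (simp_all add: a_def)
  let ?A = "complex_of_real t \<cdot>\<^sub>m A1 + complex_of_real (1 - t) \<cdot>\<^sub>m A2"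
  let ?B = "complex_of_real t \<cdot>\<^sub>m B1 + complex_of_real (1 - t) \<cdot>\<^sub>m B2"
  have sw: "\<exists>U \<alpha> V l. sandwich_spectral n a A B U \<alpha> V l \<and> Phi 2 q s A B = (\<Sum>i<n. l i powr s)"
    if "A \<in> pos_def_mats n" "B \<in> pos_def_mats n" for A B
    using Phi_2_spectral[OF that, of q s] that(2)
    by (auto simp: sandwich_spectral_def a_def pos_def_mats_def)
  obtain U \<alpha> V l where S: "sandwich_spectral n a ?A ?B U \<alpha> V l" "Phi 2 q s ?A ?B = (\<Sum>i<n. l i powr s)"
    using sw[OF pos_def_convex[OF pd(1,3)] pos_def_convex[OF pd(2,4)]] t by blast
  obtain U1 \<alpha>1 V1 l1 where S1: "sandwich_spectral n a A1 B1 U1 \<alpha>1 V1 l1" "Phi 2 q s A1 B1 = (\<Sum>i<n. l1 i powr s)"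
    using sw[OF pd(1,2)] by blast
  obtain U2 \<alpha>2 V2 l2 where S2: "sandwich_spectral n a A2 B2 U2 \<alpha>2 V2 l2" "Phi 2 q s A2 B2 = (\<Sum>i<n. l2 i powr s)"
    using sw[OF pd(3,4)] by blast
  have AB: "convex_combination_mat n t ?A A1 A2" "convex_combination_mat n t ?B B1 B2"
    using pd by (auto simp: convex_combination_mat_def pos_def_mats_def)
  show "Phi 2 q s ?A ?B \<le> t * Phi 2 q s A1 B1 + (1 - t) * Phi 2 q s A2 B2"
    unfolding S(2) S1(2) S2(2)
    using sandwich_powr_convex_ge_1[OF S(1) S1(1) S2(1) AB _ _ a(1,2)]
      sandwich_powr_convex_less_1[OF S(1) S1(1) S2(1) AB _ _ a(1) _ a(3,2)] t
    by (cases "s < 1") auto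
qed

end
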